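(* Let $0<\alpha<1$ and $0\le q<1$. For a parameter $a$, consider the map $$x(t+1)=x(0)+(a-1)\sum_{j=0}^{t}\tilde{\phi}_{\alpha,q}(t-j)\,x(j),\qquad t=0,1,2,\dots,$$ where $\tilde{\phi}_{\alpha,q}(t)=\prod_{k=1}^{t}\frac{1-q^{\alpha+k-1}}{1-q^{k}}$. Put $$\Lambda_{q,\alpha}=\frac{(-1;q)_\infty}{(-q^{\alpha};q)_\infty}.$$ (i) If $a$ is real and $1-\Lambda_{q,\alpha}<a<1$, then the zero solution of the map is locally asymptotically stable. (ii) If $a$ is allowed to take complex values, then the stability region (the set of $a\in\mathbb{C}$ for which the zero solution is asymptotically stable) is bounded in the complex plane by the parametric curve $$\gamma(\theta)=1+\frac{e^{i\theta}\,(e^{-i\theta};q)_\infty}{(q^{\alpha}e^{-i\theta};q)_\infty},\qquad 0\le\theta<2\pi.$$ The curve $\gamma$ is a positively oriented, simple, bounded closed curve, and the zero solution is asymptotically stable whenever $a$ lies inside $\gamma$.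
   Context: For $|q|<1$ and $b\in\mathbb{C}$, $(b;q)_\infty=\prod_{k=0}^{\infty}(1-bq^k)$ is the infinite $q$-Pochhammer symbol, with the convention $q^0=1$ also when $q=0$. The kernel $\tilde\phi_{\alpha,q}(t)$ is the Gaussian binomial coefficient $\binom{t+\alpha-1}{t}_q$, with $\tilde\phi_{\alpha,q}(0)=1$ (empty product). For a given $a$, the sequence $(x(t))_{t\ge 0}$ is determined by $x(0)$ (real when $a$ is real, complex when $a$ is complex). The zero solution is stable if for every $\epsilon>0$ there is $\delta>0$ such that $|x(0)|<\delta$ implies $|x(t)|<\epsilon$ for all $t\ge1$; it is (locally) asymptotically stable if it is stable and there is $\delta>0$ such that $|x(0)|<\delta$ implies $\lim_{t\to\infty}x(t)=0$. *)

theory Defs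
  imports "HOL-Complex_Analysis.Complex_Analysis"
begin

text \<open>The infinite q-Pochhammer symbol. A factor may vanish, in which case the library's
  infinite product is \<open>0\<close>; at \<open>q = 0\<close> we have \<open>q ^ 0 = 1\<close>, so the value is \<open>1 - b\<close>.\<close>

definition qpoch_inf :: "'a::real_normed_field \<Rightarrow> 'a \<Rightarrow> 'a" where
  "qpoch_inf b q = (\<Prod>k. 1 - b * q ^ k)"

text \<open>Every real exponent below is positive, so \<open>0 powr _ = 0\<close> is the intended value at \<open>q = 0\<close>.\<close>

definition phi_kernel :: "real \<Rightarrow> real \<Rightarrow> nat \<Rightarrow> real" where
  "phi_kernel \<alpha> q t = (\<Prod>k=1..t. (1 - q powr (\<alpha> + real k - 1)) / (1 - q ^ k))"

text \<open>The scalar type is \<open>real\<close> for real parameters \<open>a\<close> and \<open>complex\<close> for complex ones. For each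
  initial value there is exactly one trajectory.\<close>

definition trajectory :: "real \<Rightarrow> real \<Rightarrow> 'a::real_normed_field \<Rightarrow> (nat \<Rightarrow> 'a) \<Rightarrow> bool" where
  "trajectory \<alpha> q a x \<longleftrightarrow>
     (\<forall>t. x (t + 1) = x 0 + (a - 1) * (\<Sum>j=0..t. of_real (phi_kernel \<alpha> q (t - j)) * x j))"

definition zero_stable :: "real \<Rightarrow> real \<Rightarrow> 'a::real_normed_field \<Rightarrow> bool" where
  "zero_stable \<alpha> q a \<longleftrightarrow>
     (\<forall>\<epsilon>>0. \<exists>\<delta>>0. \<forall>x. trajectory \<alpha> q a x \<longrightarrow> norm (x 0) < \<delta> \<longrightarrow> (\<forall>t\<ge>1. norm (x t) < \<epsilon>))"

definition zero_asymp_stable :: "real \<Rightarrow> real \<Rightarrow> 'a::real_normed_field \<Rightarrow> bool" where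
  "zero_asymp_stable \<alpha> q a \<longleftrightarrow>
     zero_stable \<alpha> q a \<and>
     (\<exists>\<delta>>0. \<forall>x. trajectory \<alpha> q a x \<longrightarrow> norm (x 0) < \<delta> \<longrightarrow> x \<longlonglongrightarrow> 0)"

definition Lambda :: "real \<Rightarrow> real \<Rightarrow> real" where
  "Lambda q \<alpha> = qpoch_inf (-1) q / qpoch_inf (- (q powr \<alpha>)) q"

definition stability_region :: "real \<Rightarrow> real \<Rightarrow> complex set" where
  "stability_region \<alpha> q = {a. zero_asymp_stable \<alpha> q a}"

definition gamma_curve :: "real \<Rightarrow> real \<Rightarrow> real \<Rightarrow> complex" where
  "gamma_curve \<alpha> q \<theta> =
     1 + exp (\<i> * of_real \<theta>) * qpoch_inf (exp (- \<i> * of_real \<theta>)) (of_real q)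
         / qpoch_inf (of_real (q powr \<alpha>) * exp (- \<i> * of_real \<theta>)) (of_real q)"

text \<open>Library paths are parametrised by the unit interval, so the angle is rescaled.\<close>

definition gamma_path :: "real \<Rightarrow> real \<Rightarrow> real \<Rightarrow> complex" where
  "gamma_path \<alpha> q = (\<lambda>s. gamma_curve \<alpha> q (2 * pi * s))"

text \<open>For simple closed paths; the inside is then nonempty, by the Jordan curve theorem.\<close>

definition positively_oriented :: "(real \<Rightarrow> complex) \<Rightarrow> bool" where
  "positively_oriented g \<longleftrightarrow> (\<forall>z \<in> inside (path_image g). winding_number g z = 1)"

end

theory Submission
  imports Defs
begin

text \<open>
  Write \<open>P = q\<^sup>\<alpha>\<close> and let \<open>\<Phi>\<close> be the generating function of the kernel. Passing to generating functions,
  the map becomes \<open>X(w) (1 - (a - 1) w \<Phi>(w)) = x(0) / (1 - w)\<close>. By the $q$-binomial theorem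
  \<open>1 / \<Phi>(w) = (w; q)\<^sub>\<infinity> / (P w; q)\<^sub>\<infinity> = (1 - w) K(w)\<close>, where \<open>K\<close> is holomorphic in a disc of radius greater
  than \<open>1\<close>. Hence \<open>X = x(0) K / char_fun a\<close> with \<open>char_fun a w = (1 - w) K(w) - (a - 1) w\<close>.
  If \<open>char_fun a\<close> has no zero in the closed unit disc, \<open>X\<close> converges beyond the unit circle and
  \<open>x(t)\<close> tends to \<open>0\<close>; a zero in the closed disc is a pole of \<open>X\<close> because \<open>Re K > 0\<close> there, and a pole
  on or inside the circle is incompatible with \<open>x(t)\<close> tending to \<open>0\<close>. So the zero solution is
  not asymptotically stable exactly if \<open>a = 1 + F(w)\<close> for some \<open>0 < \<bar>w\<bar> \<le> 1\<close>, where \<open>F(w) = (1 - w) K(w) / w\<close>. The curve is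
  the image of the unit circle under \<open>1 + F\<close> (\<open>stability_region_complement\<close>).

  The analytic core is that \<open>F\<close> is injective on the unit circle (\<open>F_inj_on_circle\<close>). The coefficients of
  \<open>K\<close> are the moments of a discrete probability measure with masses \<open>\<nu> k\<close> at the points
  \<open>p k = P q\<^sup>k\<close> of \<open>[0, 1)\<close> (\<open>h_moment\<close>), so \<open>K(w)\<close> is the sum of \<open>\<nu> k / (1 - p k w)\<close>, and up to a nonzero factor
  a difference quotient of \<open>F\<close> is a convex combination of the quotients \<open>A / B\<close> with \<open>A = 1 - p + p (1 - w1) (1 - w2)\<close>
  and \<open>B = (1 - p w1) (1 - p w2)\<close>. If \<open>w1\<close> and \<open>w2\<close> have modulus \<open>1\<close>
  and \<open>\<sigma>\<^sup>2 = w1 w2\<close>, then \<open>(1 - w1) (1 - w2)\<close> is a real multiple of \<open>\<sigma>\<close>, and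
  the imaginary part of \<open>\<sigma> A / B\<close> is a positive multiple of \<open>Im \<sigma>\<close> for every \<open>p\<close> in \<open>[0, 1)\<close>
  (\<open>Im_rotated_quotient\<close>). The terms cannot cancel, and the degenerate case \<open>w1 w2 = 1\<close> of
  conjugate points has positive terms.

  The rest is topology. The curve is a Jordan curve. For stable \<open>a\<close> the function \<open>char_fun a\<close> has a
  logarithm on the disc, so \<open>1 + F - a = char_fun a / w\<close> winds once (\<open>winding_number_gamma\<close>), and \<open>a\<close> is
  inside. The image of the punctured open disc under \<open>1 + F\<close> is open and so is the stability region;
  together they cover the connected inside of the curve, which therefore is the stability region
  (\<open>stability_region_eq_inside\<close>). For the real interval, \<open>F\<close> is real in the closed disc only on the
  real axis, nonnegative on \<open>(0, 1]\<close> and at most \<open>F (- 1) = - Lambda\<close> on \<open>[- 1, 0)\<close>.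
\<close>

section \<open>Difference equations in q and infinite products\<close>

text \<open>The mechanism behind the $q$-binomial theorem: a two-term recurrence for coefficients is the same
  as a first-order \<open>q\<close>-difference equation for their power series. It serves three times below: for
  the kernel on the real line, for the kernel on the complex disc, and for the reciprocal.\<close>

lemma q_difference_equation:
  fixes u :: "nat \<Rightarrow> 'a::{real_normed_field,banach}"
  assumes rec: "\<And>n. u (Suc n) * (1 - Q ^ Suc n) = u n * (c - d * Q ^ n)"
    and s1: "summable (\<lambda>n. u n * x ^ n)" and s2: "summable (\<lambda>n. u n * (Q * x) ^ n)"
  shows "(1 - c * x) * (\<Sum>n. u n * x ^ n) = (1 - d * x) * (\<Sum>n. u n * (Q * x) ^ n)"
proof -
  define U V where "U = (\<Sum>n. u n * x ^ n)" and "V = (\<Sum>n. u n * (Q * x) ^ n)"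
  have "U - V = (\<Sum>n. u n * x ^ n - u n * (Q * x) ^ n)"
    unfolding U_def V_def by (rule suminf_diff[OF s1 s2])
  also have "\<dots> = (\<Sum>n. u (Suc n) * x ^ Suc n - u (Suc n) * (Q * x) ^ Suc n)"
    by (subst suminf_split_head[OF summable_diff[OF s1 s2]]) simp
  also have "\<dots> = (\<Sum>n. x * (c * (u n * x ^ n) - d * (u n * (Q * x) ^ n)))"
  proof (rule suminf_cong)
    fix n
    have "u (Suc n) * x ^ Suc n - u (Suc n) * (Q * x) ^ Suc n
        = (u (Suc n) * (1 - Q ^ Suc n)) * x ^ Suc n"
      by (simp add: algebra_simps power_mult_distrib)
    also have "\<dots> = x * (c * (u n * x ^ n) - d * (u n * (Q * x) ^ n))"
      by (subst rec) (simp add: algebra_simps power_mult_distrib)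
    finally show "u (Suc n) * x ^ Suc n - u (Suc n) * (Q * x) ^ Suc n
      = x * (c * (u n * x ^ n) - d * (u n * (Q * x) ^ n))" .
  qed
  also have "\<dots> = x * (c * U - d * V)"
    unfolding U_def V_def
    by (subst suminf_mult, intro summable_diff summable_mult s1 s2)
       (simp add: suminf_diff[symmetric] suminf_mult s1 s2 summable_mult)
  finally show ?thesis unfolding U_def[symmetric] V_def[symmetric] by (simp add: algebra_simps)
qed

lemma qpoch_inf_LIMSEQ:
  fixes b q :: "'a::{real_normed_field,banach}"
  assumes q: "norm q < 1"
  shows "(\<lambda>n. \<Prod>k<n. 1 - b * q ^ k) \<longlonglongrightarrow> qpoch_inf b q"
    and "(\<And>k. b * q ^ k \<noteq> 1) \<Longrightarrow> qpoch_inf b q \<noteq> 0"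
proof -
  have "summable (\<lambda>k. norm ((1 - b * q ^ k) - 1))"
    using q by (simp add: norm_mult norm_power summable_mult summable_geometric)
  then have conv: "convergent_prod (\<lambda>k. 1 - b * q ^ k)"
    by (intro abs_convergent_prod_imp_convergent_prod summable_imp_abs_convergent_prod)
  from convergent_prod_LIMSEQ[OF conv]
  have "(\<lambda>n. \<Prod>k<Suc n. 1 - b * q ^ k) \<longlonglongrightarrow> qpoch_inf b q"
    unfolding qpoch_inf_def lessThan_Suc_atMost .
  then show "(\<lambda>n. \<Prod>k<n. 1 - b * q ^ k) \<longlonglongrightarrow> qpoch_inf b q"
    by (rule LIMSEQ_imp_Suc)
  show "(\<And>k. b * q ^ k \<noteq> 1) \<Longrightarrow> qpoch_inf b q \<noteq> 0"
    unfolding qpoch_inf_def using prodinf_nonzero[OF conv] by auto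
qed

section \<open>The kernel and the coefficients of its reciprocal\<close>

text \<open>At \<open>q = 0\<close> the constants \<open>P\<close> and \<open>s\<close> below are both \<open>0\<close>, the recurrences degenerate consistently,
  so that the statements cover this case as well.\<close>

locale fractional_q =
  fixes \<alpha> q :: real
  assumes alpha_pos: "0 < \<alpha>" and alpha_less: "\<alpha> < 1" and q_nonneg: "0 \<le> q" and q_less: "q < 1"
begin

definition P :: real where "P = q powr \<alpha>"

lemma P_nonneg: "0 \<le> P" unfolding P_def by simp

lemma P_less: "P < 1"
  unfolding P_def using alpha_pos q_nonneg q_less by (cases "q = 0") (auto simp: powr01_less_one)

lemma q_le_P: "q \<le> P"
  unfolding P_def using alpha_less q_nonneg q_less powr_mono'[of \<alpha> 1 q] by (cases "q = 0") auto

lemma q_power_less: "q ^ Suc n < 1"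
  using q_nonneg q_less by (metis power_Suc_less_one power_0 not_less le_less power_0_Suc zero_less_one)

definition s :: real where "s = q powr (1 - \<alpha>)"

lemma s_nonneg: "0 \<le> s" unfolding s_def by simp

lemma s_less: "s < 1"
  unfolding s_def using alpha_less q_nonneg q_less by (cases "q = 0") (auto simp: powr01_less_one)

lemma P_times_s: "P * s = q"
  unfolding P_def s_def using q_nonneg by (simp flip: powr_add)

abbreviation \<phi> :: "nat \<Rightarrow> real" where "\<phi> \<equiv> phi_kernel \<alpha> q"

lemma phi_0: "\<phi> 0 = 1" by (simp add: phi_kernel_def)

lemma phi_Suc: "\<phi> (Suc n) * (1 - q ^ Suc n) = \<phi> n * (1 - P * q ^ n)"
proof -
  have "q powr (\<alpha> + real n) = P * q ^ n"
    unfolding P_def using q_nonneg alpha_pos by (cases "q = 0") (auto simp: powr_add powr_realpow)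
  then show ?thesis
    using q_power_less[of n] by (simp add: phi_kernel_def prod.nat_ivl_Suc')
qed

text \<open>Each factor of the kernel is at most \<open>1\<close> because \<open>\<alpha> < 1\<close> gives \<open>q \<le> P\<close>.\<close>

lemma phi_bounds: "0 \<le> \<phi> n \<and> \<phi> n \<le> 1"
proof (induction n)
  case (Suc n)
  have "q ^ Suc n \<le> P * q ^ n" "P * q ^ n \<le> 1"
    using q_le_P q_nonneg P_nonneg P_less q_less
    by (auto intro!: mult_right_mono mult_le_one power_le_one)
  then have "0 \<le> (1 - P * q ^ n) / (1 - q ^ Suc n)" "(1 - P * q ^ n) / (1 - q ^ Suc n) \<le> 1"
    using q_power_less[of n] by (auto simp: divide_simps)
  then have "0 \<le> \<phi> n * ((1 - P * q ^ n) / (1 - q ^ Suc n))" "\<phi> n * ((1 - P * q ^ n) / (1 - q ^ Suc n)) \<le> 1"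
    using Suc by (blast intro: mult_le_one mult_nonneg_nonneg)+
  moreover have "\<phi> (Suc n) = \<phi> n * ((1 - P * q ^ n) / (1 - q ^ Suc n))"
    using phi_Suc[of n] q_power_less[of n] by (simp add: field_simps)
  ultimately show ?case by (simp only:)
qed (simp add: phi_0)

lemma summable_phi:
  fixes x :: "'a::{real_normed_field,banach}"
  assumes "norm x < 1"
  shows "summable (\<lambda>n. of_real (\<phi> n) * x ^ n)"
proof (rule summable_comparison_test'[where N = 0])
  show "summable (\<lambda>n. norm x ^ n)" using assms by (simp add: summable_geometric)
  show "norm (of_real (\<phi> n) * x ^ n) \<le> norm x ^ n" for n
    using phi_bounds[of n] by (simp add: norm_mult norm_power mult_left_le_one_le)
qed

text \<open>By the $q$-binomial theorem these are the Taylor coefficients of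
  \<open>(q w; q)\<^sub>\<infinity> / (P w; q)\<^sub>\<infinity>\<close>, that is, of the reciprocal of \<open>1 - w\<close> times the generating function of
  the kernel.\<close>

definition h :: "nat \<Rightarrow> real" where
  "h n = (\<Prod>k<n. (P - q ^ Suc k) / (1 - q ^ Suc k))"

lemma h_0: "h 0 = 1" by (simp add: h_def)

lemma h_Suc: "h (Suc n) * (1 - q ^ Suc n) = h n * (P - q * q ^ n)"
  using q_power_less[of n] by (simp add: h_def)

lemma h_bounds: "0 \<le> h n \<and> h n \<le> P ^ n"
proof (induction n)
  case (Suc n)
  have "q ^ Suc n \<le> P * q ^ 0"
    using q_le_P q_nonneg P_nonneg q_less 
    by (metis power_Suc_le_self less_imp_le order_trans mult.right_neutral power_0)
  moreover have "P - q ^ Suc n \<le> P * (1 - q ^ Suc n)"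
    using mult_right_mono[of P 1 "q ^ Suc n"] P_less q_nonneg by (simp add: algebra_simps)
  ultimately have "0 \<le> (P - q ^ Suc n) / (1 - q ^ Suc n)" "(P - q ^ Suc n) / (1 - q ^ Suc n) \<le> P"
    using q_power_less[of n] by (auto simp: divide_simps)
  then have "0 \<le> h n * ((P - q ^ Suc n) / (1 - q ^ Suc n))"
     "h n * ((P - q ^ Suc n) / (1 - q ^ Suc n)) \<le> P ^ n * P"
    using Suc P_nonneg by (blast intro: mult_mono mult_nonneg_nonneg zero_le_power)+
  then show ?case by (simp add: h_def mult.commute)
qed (simp add: h_0)

definition Phi_s :: real where "Phi_s = (\<Sum>k. \<phi> k * s ^ k)"

text \<open>The masses of a probability measure on the points \<open>P q\<^sup>k\<close> whose moments turn out to be the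
  coefficients \<open>h\<close>.\<close>

definition \<nu> :: "nat \<Rightarrow> real" where "\<nu> k = \<phi> k * s ^ k / Phi_s"

lemma Phi_s_pos: "Phi_s > 0"
proof -
  have "summable (\<lambda>k. \<phi> k * s ^ k)" using summable_phi[of s] s_nonneg s_less by simp
  then have "(\<Sum>k<1. \<phi> k * s ^ k) \<le> Phi_s"
    unfolding Phi_s_def using phi_bounds s_nonneg by (intro sum_le_suminf) auto
  then show ?thesis by (simp add: phi_0)
qed

lemma nu_nonneg: "0 \<le> \<nu> k"
  unfolding \<nu>_def using phi_bounds[of k] s_nonneg Phi_s_pos by simp

lemma nu_0_pos: "0 < \<nu> 0"
  unfolding \<nu>_def using Phi_s_pos by (simp add: phi_0)

lemma nu_sums: "\<nu> sums 1"
proof -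
  have "summable (\<lambda>k. \<phi> k * s ^ k)" using summable_phi[of s] s_nonneg s_less by simp
  then have "(\<lambda>k. \<phi> k * s ^ k) sums Phi_s" unfolding Phi_s_def by (rule summable_sums)
  from sums_divide[OF this, of Phi_s] show ?thesis using Phi_s_pos unfolding \<nu>_def by simp
qed

definition p :: "nat \<Rightarrow> real" where "p k = P * q ^ k"

lemma p_bounds: "0 \<le> p k \<and> p k \<le> P \<and> p k < 1"
proof -
  have "p k \<le> P" unfolding p_def using P_nonneg q_nonneg q_less by (simp add: mult_left_le power_le_one)
  then show ?thesis using P_less P_nonneg q_nonneg unfolding p_def by auto
qed

text \<open>The \<open>n\<close>-th moment of \<open>\<nu>\<close> is \<open>P\<^sup>n\<close> times the kernel's generating function at \<open>s q\<^sup>n\<close>, up to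
  normalisation. The difference equation of that function at \<open>s q\<^sup>n\<close> relates consecutive moments, and
  since \<open>P s = q\<close> the relation is exactly the recurrence of \<open>h\<close>.\<close>

lemma h_moment: "(\<lambda>k. \<nu> k * p k ^ n) sums h n"
proof -
  define m where "m n = P ^ n * (\<Sum>k. \<phi> k * (s * q ^ n) ^ k)" for n
  have less: "norm (s * q ^ n) < 1" for n
    using s_nonneg s_less q_nonneg q_less
    by (simp add: abs_mult) (metis mult_left_le power_le_one less_imp_le order_le_less_trans)
  have less': "norm (q * (s * q ^ n)) < 1" for n
    using less[of "Suc n"] by (simp add: mult_ac)
  have summ: "summable (\<lambda>k. \<phi> k * (s * q ^ n) ^ k)" for n
    using summable_phi[OF less[of n]] by simp
  have m_Suc: "m (Suc n) * (1 - q ^ Suc n) = m n * (P - q * q ^ n)" for n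
  proof -
    have "(1 - 1 * (s * q ^ n)) * (\<Sum>k. \<phi> k * (s * q ^ n) ^ k)
        = (1 - P * (s * q ^ n)) * (\<Sum>k. \<phi> k * (q * (s * q ^ n)) ^ k)"
      using summable_phi[OF less[of n]] summable_phi[OF less'[of n]]
      by (intro q_difference_equation) (auto simp: phi_Suc simp del: power_Suc)
    moreover have "P * (s * q ^ n) = q * q ^ n" using P_times_s by (metis mult.assoc)
    moreover have "q * (s * q ^ n) = s * q ^ Suc n" by simp
    ultimately have eq: "(1 - s * q ^ n) * (\<Sum>k. \<phi> k * (s * q ^ n) ^ k)
        = (1 - q ^ Suc n) * (\<Sum>k. \<phi> k * (s * q ^ Suc n) ^ k)" by simp
    have "m (Suc n) * (1 - q ^ Suc n) = P ^ Suc n * ((1 - s * q ^ n) * (\<Sum>k. \<phi> k * (s * q ^ n) ^ k))"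
      unfolding m_def eq by (simp only: mult_ac)
    also have "\<dots> = m n * (P - (P * s) * q ^ n)" unfolding m_def by (simp add: algebra_simps)
    finally show ?thesis by (simp only: P_times_s)
  qed
  have "h n = m n / Phi_s" for n
  proof (induction n)
    case 0 show ?case using Phi_s_pos by (simp add: h_0 m_def Phi_s_def)
  next
    case (Suc n)
    have "h (Suc n) * (1 - q ^ Suc n) = m (Suc n) / Phi_s * (1 - q ^ Suc n)"
      unfolding h_Suc Suc.IH times_divide_eq_left m_Suc ..
    moreover have "1 - q ^ Suc n \<noteq> 0" using q_power_less[of n] by simp
    ultimately show ?case by (simp only: mult_cancel_right) simp
  qed
  moreover have "(\<lambda>k. P ^ n * (\<phi> k * (s * q ^ n) ^ k) / Phi_s) sums (m n / Phi_s)"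
    unfolding m_def by (intro sums_divide sums_mult summable_sums summ)
  moreover have "P ^ n * (\<phi> k * (s * q ^ n) ^ k) / Phi_s = \<nu> k * p k ^ n" for k
    unfolding \<nu>_def p_def by (simp add: power_mult_distrib flip: power_mult) (simp add: mult.commute)
  ultimately show ?thesis by simp
qed

end

section \<open>The reciprocal generating function\<close>

text \<open>Links the real constant \<open>Lambda\<close> with complex infinite products.\<close>

lemma of_real_qpoch_inf:
  fixes b q :: real
  assumes "norm q < 1"
  shows "(of_real (qpoch_inf b q) :: 'a::{real_normed_field,banach}) = qpoch_inf (of_real b) (of_real q)"
proof (rule LIMSEQ_unique)
  show "(\<lambda>n. \<Prod>k<n. 1 - (of_real b :: 'a) * of_real q ^ k) \<longlonglongrightarrow> of_real (qpoch_inf b q)"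
    using tendsto_of_real[OF qpoch_inf_LIMSEQ(1)[OF assms, of b], where ?'a = 'a] by simp
  show "(\<lambda>n. \<Prod>k<n. 1 - (of_real b :: 'a) * of_real q ^ k) \<longlonglongrightarrow> qpoch_inf (of_real b) (of_real q)"
    using assms by (intro qpoch_inf_LIMSEQ) simp
qed

context fractional_q begin

definition K_fps :: "complex fps" where "K_fps = Abs_fps (\<lambda>n. of_real (h n))"
definition \<Phi>_fps :: "complex fps" where "\<Phi>_fps = Abs_fps (\<lambda>n. of_real (\<phi> n))"
definition K :: "complex \<Rightarrow> complex" where "K = eval_fps K_fps"

text \<open>Any radius strictly between \<open>1\<close> and \<open>1 / P\<close> would do; this choice also covers \<open>P = 0\<close>.\<close>

definition R :: real where "R = 2 / (1 + P)"

lemma R_gt_1: "1 < R" and P_R: "P * R < 1"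
  unfolding R_def using P_nonneg P_less by (auto simp: divide_simps)

lemma summable_h:
  fixes w :: "'a::{real_normed_field,banach}"
  assumes "P * norm w < 1"
  shows "summable (\<lambda>n. of_real (h n) * w ^ n)"
proof (rule summable_comparison_test'[where N = 0])
  show "summable (\<lambda>n. (P * norm w) ^ n)" using assms P_nonneg by (simp add: summable_geometric abs_mult)
  show "norm (of_real (h n) * w ^ n) \<le> (P * norm w) ^ n" for n
    using h_bounds[of n] by (simp add: norm_mult norm_power power_mult_distrib mult_right_mono)
qed

lemma conv_radius_K: "fps_conv_radius K_fps \<ge> ereal R"
  using conv_radius_geI[OF summable_h[of "of_real R :: complex"]] R_gt_1 P_R
  by (simp add: fps_conv_radius_def K_fps_def)

lemma conv_radius_Phi: "fps_conv_radius \<Phi>_fps \<ge> 1"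
  unfolding fps_conv_radius_def
proof (rule conv_radius_geI_ex')
  fix r :: real assume "0 < r" "ereal r < 1"
  then show "summable (\<lambda>n. fps_nth \<Phi>_fps n * of_real r ^ n)"
    using summable_phi[of "of_real r :: complex"] by (simp add: \<Phi>_fps_def)
qed

lemma K_0: "K 0 = 1" by (simp add: K_def eval_fps_at_0 K_fps_def h_0)

lemma K_holomorphic: "K holomorphic_on ball 0 R"
  unfolding K_def
proof (rule holomorphic_on_eval_fps, rule subsetI)
  fix x :: complex assume "x \<in> ball 0 R"
  then have "ereal (norm x) < ereal R" by simp
  then show "x \<in> eball 0 (fps_conv_radius K_fps)"
    using conv_radius_K by (metis in_eball_iff dist_0_norm order_less_le_trans)
qed

lemma K_isCont_0: "isCont K 0"
  using K_holomorphic R_gt_1 holomorphic_on_imp_continuous_on[of K "ball 0 R"]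
  by (simp add: continuous_on_eq_continuous_at)

lemma norm_q_mult: "norm (of_real q * w :: complex) \<le> norm w"
  using q_nonneg q_less by (simp add: norm_mult mult_left_le_one_le)

lemma K_q_difference:
  assumes "norm w \<le> 1"
  shows "(1 - of_real P * w) * K w = (1 - of_real q * w) * K (of_real q * w)"
proof -
  have "P * norm w < 1" "P * norm (of_real q * w) < 1"
    using assms norm_q_mult[of w] P_nonneg P_less
    by (metis mult_left_le order_le_less_trans order_trans)+
  then show ?thesis
    unfolding K_def eval_fps_def K_fps_def fps_nth_Abs_fps
  proof (intro q_difference_equation summable_h)
    show "complex_of_real (h (Suc n)) * (1 - of_real q ^ Suc n)
        = of_real (h n) * (of_real P - of_real q * of_real q ^ n)" for n
      using arg_cong[OF h_Suc[of n], where f = complex_of_real] by simp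
  qed auto
qed

lemma LIMSEQ_q_power_mult: "(\<lambda>n. of_real q ^ n * w) \<longlonglongrightarrow> (0::complex)"
  using q_nonneg q_less by (intro tendsto_mult_left_zero LIMSEQ_power_zero) simp

lemma norm_q_power_mult: "norm (of_real q ^ n * w :: complex) \<le> norm w"
  using q_nonneg q_less by (simp add: norm_mult norm_power mult_left_le_one_le power_le_one)

text \<open>Iterating \<open>w \<mapsto> q w\<close> in the difference equation of \<open>K\<close> peels off one factor of either product at
  a time, and \<open>K\<close> tends to \<open>K 0 = 1\<close> at the origin. The bound includes the unit circle, on which the
  curve is defined.\<close>

lemma q_pochhammer_quotient:
  assumes w: "norm w \<le> 1"
  shows "qpoch_inf w (of_real q) / qpoch_inf (of_real P * w) (of_real q) = (1 - w) * K w"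
proof -
  have q: "norm (complex_of_real q) < 1" using q_nonneg q_less by simp
  have step: "(\<Prod>k<n. 1 - of_real P * w * of_real q ^ k) * ((1 - w) * K w)
      = (\<Prod>k<n. 1 - w * of_real q ^ k) * ((1 - of_real q ^ n * w) * K (of_real q ^ n * w))" for n
  proof (induction n)
    case (Suc n)
    have "(1 - of_real P * (of_real q ^ n * w)) * K (of_real q ^ n * w)
        = (1 - of_real q * (of_real q ^ n * w)) * K (of_real q * (of_real q ^ n * w))"
      using norm_q_power_mult[of n w] w by (intro K_q_difference) simp
    then have eq: "(1 - of_real P * w * of_real q ^ n) * K (of_real q ^ n * w)
        = (1 - of_real q ^ Suc n * w) * K (of_real q ^ Suc n * w)" by (simp add: mult_ac)
    have "(\<Prod>k<Suc n. 1 - of_real P * w * of_real q ^ k) * ((1 - w) * K w)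
        = (1 - of_real P * w * of_real q ^ n) * ((\<Prod>k<n. 1 - w * of_real q ^ k)
            * ((1 - of_real q ^ n * w) * K (of_real q ^ n * w)))"
      unfolding Suc[symmetric] by (simp add: mult_ac)
    also have "\<dots> = (\<Prod>k<n. 1 - w * of_real q ^ k) * (1 - w * of_real q ^ n)
            * ((1 - of_real P * w * of_real q ^ n) * K (of_real q ^ n * w))"
      by (simp only: mult_ac)
    finally show ?case unfolding eq by simp
  qed simp
  have "(\<lambda>n. (\<Prod>k<n. 1 - of_real P * w * of_real q ^ k) * ((1 - w) * K w))
      \<longlonglongrightarrow> qpoch_inf (of_real P * w) (of_real q) * ((1 - w) * K w)"
    by (intro tendsto_intros qpoch_inf_LIMSEQ q)
  moreover have "(\<lambda>n. (\<Prod>k<n. 1 - w * of_real q ^ k) * ((1 - of_real q ^ n * w) * K (of_real q ^ n * w)))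
      \<longlonglongrightarrow> qpoch_inf w (of_real q) * ((1 - 0) * K 0)"
    by (intro tendsto_intros qpoch_inf_LIMSEQ q LIMSEQ_q_power_mult isCont_tendsto_compose[OF K_isCont_0])
  ultimately have "qpoch_inf (of_real P * w) (of_real q) * ((1 - w) * K w) = qpoch_inf w (of_real q)"
    unfolding step using LIMSEQ_unique K_0 by fastforce
  moreover have "qpoch_inf (of_real P * w) (of_real q) \<noteq> 0"
  proof (rule qpoch_inf_LIMSEQ(2)[OF q])
    fix k
    have "norm (of_real P * w * of_real q ^ k) = P * norm (of_real q ^ k * w)"
      using P_nonneg by (simp add: norm_mult mult_ac)
    also have "\<dots> \<le> P" using norm_q_power_mult[of k w] w P_nonneg by (intro mult_left_le) auto
    also have "\<dots> < 1" by (rule P_less)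
    finally show "of_real P * w * of_real q ^ k \<noteq> 1" by auto
  qed
  ultimately show ?thesis by (simp add: field_simps)
qed

text \<open>The difference equations of \<open>K\<close> and of the generating function of the kernel combine to say that
  the product \<open>E\<close> below is unchanged under \<open>w \<mapsto> q w\<close>; by continuity at the origin it is constant.\<close>

lemma K_times_Phi: "(1 - fps_X) * K_fps * \<Phi>_fps = 1"
proof -
  define \<Phi> where "\<Phi> = eval_fps \<Phi>_fps"
  define E where "E w = (1 - w) * K w * \<Phi> w" for w
  have Phi_q_difference: "(1 - w) * \<Phi> w = (1 - of_real P * w) * \<Phi> (of_real q * w)"
    if "norm w < 1" for w
  proof -
    have "norm (of_real q * w) < 1" using norm_q_mult[of w] that by simp
    with that have "(1 - 1 * w) * \<Phi> w = (1 - of_real P * w) * \<Phi> (of_real q * w)"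
      unfolding \<Phi>_def eval_fps_def \<Phi>_fps_def fps_nth_Abs_fps
    proof (intro q_difference_equation summable_phi)
      show "complex_of_real (\<phi> (Suc n)) * (1 - of_real q ^ Suc n)
          = of_real (\<phi> n) * (1 - of_real P * of_real q ^ n)" for n
        using arg_cong[OF phi_Suc[of n], where f = complex_of_real] by simp
    qed auto
    then show ?thesis by simp
  qed
  have E_q: "E (of_real q * w) = E w" if "norm w < 1" for w
  proof -
    have "E w = K w * ((1 - w) * \<Phi> w)" by (simp add: E_def)
    also have "\<dots> = ((1 - of_real P * w) * K w) * \<Phi> (of_real q * w)"
      unfolding Phi_q_difference[OF that] by simp
    also have "\<dots> = E (of_real q * w)"
      using K_q_difference[of w] that by (simp add: E_def)
    finally show ?thesis ..
  qed
  have "0 < fps_conv_radius \<Phi>_fps" by (rule less_le_trans[OF _ conv_radius_Phi]) simp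
  then have "isCont \<Phi> 0"
    unfolding \<Phi>_def by (rule has_fps_expansion_imp_continuous[OF eval_fps_has_fps_expansion])
  then have cont: "isCont E 0" unfolding E_def by (intro continuous_intros K_isCont_0)
  have E_1: "E w = 1" if w: "norm w < 1" for w
  proof -
    have "E (of_real q ^ n * w) = E w" for n
    proof (induction n)
      case (Suc n)
      have "norm (of_real q ^ n * w) < 1" using norm_q_power_mult[of n w] w by simp
      from E_q[OF this] Suc show ?case by (simp add: mult.assoc)
    qed simp
    then have "(\<lambda>n. E w) \<longlonglongrightarrow> E 0"
      using isCont_tendsto_compose[OF cont LIMSEQ_q_power_mult[of w]] by simp
    moreover have "E 0 = 1" by (simp add: E_def K_0 \<Phi>_def eval_fps_at_0 \<Phi>_fps_def phi_0)
    ultimately show ?thesis using LIMSEQ_unique tendsto_const by metis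
  qed
  have "E has_fps_expansion (1 - fps_X) * K_fps * \<Phi>_fps"
    unfolding E_def K_def \<Phi>_def
    using \<open>0 < fps_conv_radius \<Phi>_fps\<close> less_le_trans[OF _ conv_radius_K, of 0] R_gt_1
    by (intro has_fps_expansion_mult has_fps_expansion_diff has_fps_expansion_1
        has_fps_expansion_fps_X eval_fps_has_fps_expansion) auto
  moreover have "E has_fps_expansion 1"
  proof -
    have "eventually (\<lambda>w. w \<in> ball 0 1) (nhds (0::complex))" by (intro eventually_nhds_in_open) auto
    then have "eventually (\<lambda>w. 1 = E w) (nhds 0)" by eventually_elim (use E_1 in auto)
    then show ?thesis by (simp add: has_fps_expansion_def)
  qed
  ultimately show ?thesis by (rule fps_expansion_unique_complex)
qed

end

section \<open>Partial fractions and injectivity on the unit circle\<close>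

text \<open>On the unit circle \<open>1 - cnj w = - (1 - w) / w\<close>.\<close>

lemma one_minus_unimodular_squared:
  fixes w :: complex
  assumes "norm w = 1"
  shows "(1 - w)\<^sup>2 = - w * of_real ((norm (1 - w))\<^sup>2)"
proof -
  have "w * cnj w = 1" using complex_norm_square[of w] assms by simp
  moreover have "- w * ((1 - w) * (1 - cnj w)) = (1 - w) * (w * cnj w - w)"
    by (simp add: algebra_simps)
  moreover have "of_real ((norm (1 - w))\<^sup>2) = (1 - w) * (1 - cnj w)"
    using complex_norm_square[of "1 - w"] by simp
  ultimately show ?thesis by (simp only: power2_eq_square)
qed

text \<open>The number \<open>\<sigma>\<close> is a square root of \<open>w1 w2\<close>. By the previous lemma \<open>(1 - w1) (1 - w2)\<close> is real in
  the direction of \<open>\<sigma>\<close>. The factor \<open>\<rho>\<close> may be negative.\<close>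

lemma unimodular_half_angle:
  fixes w1 w2 :: complex
  assumes "norm w1 = 1" "norm w2 = 1"
  obtains \<sigma> \<rho> where "norm \<sigma> = 1" "w1 * w2 = \<sigma>\<^sup>2" "(1 - w1) * (1 - w2) = of_real \<rho> * \<sigma>"
proof -
  define \<sigma> where "\<sigma> = csqrt (w1 * w2)"
  define r where "r = norm (1 - w1) * norm (1 - w2)"
  have sq: "\<sigma>\<^sup>2 = w1 * w2" by (simp add: \<sigma>_def)
  then have "(norm \<sigma>)\<^sup>2 = 1" using assms by (metis norm_mult norm_power mult_1)
  then have "norm \<sigma> = 1" by (metis norm_ge_zero power2_eq_1_iff norm_not_less_zero zero_less_one neg_less_0_iff_less)
  have "((1 - w1) * (1 - w2))\<^sup>2 = (1 - w1)\<^sup>2 * (1 - w2)\<^sup>2" by (simp add: power_mult_distrib)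
  also have "\<dots> = (of_real r * \<sigma>)\<^sup>2"
    unfolding one_minus_unimodular_squared[OF assms(1)] one_minus_unimodular_squared[OF assms(2)]
      power_mult_distrib sq r_def by (simp add: power_mult_distrib)
  finally have "(1 - w1) * (1 - w2) = of_real r * \<sigma> \<or> (1 - w1) * (1 - w2) = of_real (- r) * \<sigma>"
    unfolding power2_eq_iff by simp
  then show ?thesis using that \<open>norm \<sigma> = 1\<close> sq by metis
qed

text \<open>The heart of the injectivity proof. A term of the difference quotient of the symbol has the form
  \<open>A / B\<close>. Multiplying by \<open>\<sigma>\<close> makes its imaginary part a nonnegative multiple of \<open>Im \<sigma>\<close>, with one and
  the same \<open>\<sigma>\<close> for all nodes \<open>p\<close>; so terms with different \<open>p\<close> cannot cancel. The reason is that
  \<open>\<sigma> A (cnj B) = \<sigma> \<bar>A\<bar>\<^sup>2 - p (1 - p) (cnj \<sigma>) A\<close>, where \<open>(cnj \<sigma>) A\<close> is \<open>(1 - p) cnj \<sigma>\<close> up to a real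
  number.\<close>

lemma Im_rotated_quotient:
  fixes \<sigma> :: complex and p \<rho> :: real
  assumes \<sigma>: "norm \<sigma> = 1"
  defines "A \<equiv> of_real (1 - p) + of_real (p * \<rho>) * \<sigma>"
  defines "B \<equiv> A - of_real (p * (1 - p)) * \<sigma>\<^sup>2"
  shows "Im (\<sigma> * (A / B)) = Im \<sigma> * (((norm A)\<^sup>2 + p * (1 - p)\<^sup>2) / (norm B)\<^sup>2)"
proof -
  have unit: "\<sigma> * cnj \<sigma> = 1" using complex_norm_square[of \<sigma>] \<sigma> by simp
  have A1: "cnj \<sigma> * A = of_real (1 - p) * cnj \<sigma> + of_real (p * \<rho>)"
  proof -
    have "cnj \<sigma> * A = of_real (1 - p) * cnj \<sigma> + of_real (p * \<rho>) * (\<sigma> * cnj \<sigma>)"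
      unfolding A_def by (simp only: algebra_simps)
    then show ?thesis unfolding unit by simp
  qed
  have "\<sigma> * A * cnj B = \<sigma> * (A * cnj A) - of_real (p * (1 - p)) * ((\<sigma> * cnj \<sigma>) * (cnj \<sigma> * A))"
    unfolding B_def by (simp add: algebra_simps power2_eq_square)
  also have "\<dots> = \<sigma> * of_real ((norm A)\<^sup>2)
      - of_real (p * (1 - p)) * (of_real (1 - p) * cnj \<sigma> + of_real (p * \<rho>))"
    unfolding unit A1 complex_norm_square by simp
  finally have "Im (\<sigma> * A * cnj B) = Im (\<sigma> * of_real ((norm A)\<^sup>2)
      - of_real (p * (1 - p)) * (of_real (1 - p) * cnj \<sigma> + of_real (p * \<rho>)))"
    by (rule arg_cong)
  also have "\<dots> = Im \<sigma> * ((norm A)\<^sup>2 + p * (1 - p)\<^sup>2)"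
    by (simp add: algebra_simps power2_eq_square)
  finally have "Im (\<sigma> * A * cnj B) = Im \<sigma> * ((norm A)\<^sup>2 + p * (1 - p)\<^sup>2)" .
  moreover have "\<sigma> * (A / B) = (\<sigma> * A * cnj B) / of_real ((norm B)\<^sup>2)"
    by (simp add: complex_div_cnj[of A B])
  ultimately show ?thesis by (simp del: of_real_power)
qed

lemma Re_of_real_mult: "Re (of_real r * z) = r * Re z"
  and Im_of_real_mult: "Im (of_real r * z) = r * Im z"
  by simp_all

context fractional_q begin

lemma norm_p_mult:
  fixes w :: complex
  assumes "norm w \<le> 1"
  shows "norm (of_real (p k) * w) \<le> P"
proof -
  have "p k * norm w \<le> P * 1" using p_bounds[of k] assms P_nonneg by (intro mult_mono) auto
  then show ?thesis using p_bounds[of k] by (simp add: norm_mult)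
qed

lemma norm_one_minus_p_mult:
  fixes w :: complex
  assumes "norm w \<le> 1"
  shows "1 - P \<le> norm (1 - of_real (p k) * w)" "1 - of_real (p k) * w \<noteq> 0" 
    "0 < Re (1 - of_real (p k) * w)"
proof -
  show "1 - P \<le> norm (1 - of_real (p k) * w)"
    using norm_p_mult[OF assms, of k] norm_triangle_ineq2[of 1 "of_real (p k) * w"] by simp
  then show "1 - of_real (p k) * w \<noteq> 0" using P_less by auto
  show "0 < Re (1 - of_real (p k) * w)"
    using norm_p_mult[OF assms, of k] complex_Re_le_cmod[of "of_real (p k) * w"] P_less by simp
qed

lemma nu_sum_pos:
  assumes "(\<lambda>k. \<nu> k * t k) sums T" and "\<And>k. 0 < t k"
  shows "0 < T"
proof -
  have "0 < \<nu> 0 * t 0" using nu_0_pos assms(2) by simp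
  also have "\<dots> = (\<Sum>k<1. \<nu> k * t k)" by simp
  also have "\<dots> \<le> (\<Sum>k. \<nu> k * t k)"
    using assms nu_nonneg by (intro sum_le_suminf) (auto simp: sums_iff less_imp_le)
  finally show ?thesis using assms(1) by (simp add: sums_iff)
qed

text \<open>Summing the geometric series of the moments. The finite sums over \<open>n < N\<close> are exchanged with the
  sum over \<open>k\<close>, and the remainder is at most \<open>P\<^sup>N / (1 - P)\<close>.\<close>

lemma K_partial_fractions:
  assumes w: "norm w \<le> 1"
  shows "(\<lambda>k. of_real (\<nu> k) * (1 / (1 - of_real (p k) * w))) sums K w"
proof -
  define T where "T k = of_real (\<nu> k) * (1 / (1 - of_real (p k) * w))" for k
  define S where "S N = (\<Sum>n<N. of_real (h n) * w ^ n)" for N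
  have T_bound: "norm (T k) \<le> \<nu> k * (1 / (1 - P))" for k
    unfolding T_def norm_mult norm_divide
    using norm_one_minus_p_mult(1)[OF w, of k] nu_nonneg[of k] P_less
    by (auto intro!: mult_left_mono divide_left_mono mult_pos_pos)
  have sum_bound: "(\<lambda>k. \<nu> k * (1 / (1 - P))) sums (1 / (1 - P))"
    using sums_mult2[OF nu_sums, of "1 / (1 - P)"] by simp
  then have summT: "summable T"
    using summable_comparison_test'[OF sums_summable[OF sum_bound], of 0 T] T_bound by blast
  have diff: "norm (suminf T - S N) \<le> P ^ N / (1 - P)" for N
  proof -
    have "(\<lambda>k. \<Sum>n<N. of_real (\<nu> k * p k ^ n) * w ^ n) sums S N"
      unfolding S_def by (intro sums_sum sums_mult2 sums_of_real h_moment)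
    then have "(\<lambda>k. T k - (\<Sum>n<N. of_real (\<nu> k * p k ^ n) * w ^ n)) sums (suminf T - S N)"
      by (intro sums_diff summable_sums summT)
    moreover have "T k - (\<Sum>n<N. of_real (\<nu> k * p k ^ n) * w ^ n) = T k * (of_real (p k) * w) ^ N" for k
    proof -
      have "(\<Sum>n<N. of_real (\<nu> k * p k ^ n) * w ^ n) = of_real (\<nu> k) * (\<Sum>n<N. (of_real (p k) * w) ^ n)"
        by (simp add: sum_distrib_left power_mult_distrib mult_ac)
      also have "(\<Sum>n<N. (of_real (p k) * w) ^ n) = (1 - (of_real (p k) * w) ^ N) / (1 - of_real (p k) * w)"
        using norm_one_minus_p_mult(2)[OF w, of k] by (subst sum_gp_strict) auto
      finally show ?thesis using norm_one_minus_p_mult(2)[OF w, of k]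
        by (simp add: T_def divide_simps) (simp add: algebra_simps)
    qed
    ultimately have sums: "(\<lambda>k. T k * (of_real (p k) * w) ^ N) sums (suminf T - S N)" by simp
    have "norm (T k * (of_real (p k) * w) ^ N) \<le> \<nu> k * (1 / (1 - P)) * P ^ N" for k
      unfolding norm_mult[of "T k"] norm_power
      using T_bound[of k] norm_p_mult[OF w, of k] P_less nu_nonneg[of k]
      by (intro mult_mono power_mono) auto
    moreover have "(\<lambda>k. \<nu> k * (1 / (1 - P)) * P ^ N) sums (1 / (1 - P) * P ^ N)"
      by (intro sums_mult2 sum_bound)
    ultimately show ?thesis
      using norm_suminf_le[of "\<lambda>k. T k * (of_real (p k) * w) ^ N" "\<lambda>k. \<nu> k * (1 / (1 - P)) * P ^ N"] sums
      by (simp add: sums_iff)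
  qed
  have "P * norm w < 1" using w P_nonneg P_less by (metis mult_left_le order_le_less_trans)
  then have "S \<longlonglongrightarrow> K w"
    unfolding S_def K_def eval_fps_def K_fps_def fps_nth_Abs_fps
    by (rule summable_LIMSEQ[OF summable_h])
  moreover have "S \<longlonglongrightarrow> suminf T"
  proof (rule LIM_zero_cancel, rule Lim_null_comparison)
    show "\<forall>\<^sub>F N in sequentially. norm (S N - suminf T) \<le> P ^ N / (1 - P)"
      using diff by (simp add: norm_minus_commute)
    show "(\<lambda>N. P ^ N / (1 - P)) \<longlonglongrightarrow> 0"
      using P_nonneg P_less by (intro tendsto_divide_zero LIMSEQ_power_zero) simp
  qed
  ultimately have "K w = suminf T" by (rule LIMSEQ_unique)
  then show ?thesis using summable_sums[OF summT] unfolding T_def by simp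
qed

lemma Re_K_pos:
  assumes "norm w \<le> 1"
  shows "0 < Re (K w)"
proof (rule nu_sum_pos)
  show "(\<lambda>k. \<nu> k * Re (1 / (1 - of_real (p k) * w))) sums Re (K w)"
    using sums_Re[OF K_partial_fractions[OF assms]] by (simp only: Re_of_real_mult)
  show "0 < Re (1 / (1 - of_real (p k) * w))" for k
    using norm_one_minus_p_mult(2,3)[OF assms, of k]
    by (subst Re_divide) (simp add: cmod_power2[symmetric] del: minus_complex.sel)
qed

lemma K_nonzero: "norm w \<le> 1 \<Longrightarrow> K w \<noteq> 0"
  using Re_K_pos[of w] by auto

text \<open>The symbol: \<open>1 + F (exp (- \<i> \<theta>))\<close> is the boundary curve, and for \<open>w \<noteq> 0\<close> in the closed unit disc
  \<open>a = 1 + F w\<close> says that \<open>w\<close> is a pole of the generating function of a nonzero trajectory.\<close>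

definition F :: "complex \<Rightarrow> complex" where "F w = (1 - w) * K w / w"

text \<open>Up to the factor \<open>(w2 - w1) / (w1 w2)\<close>, the difference quotient of
  \<open>(1 - w) / (w (1 - p w))\<close>, which is the contribution of one node to \<open>F\<close>.\<close>

definition DQ :: "complex \<Rightarrow> complex \<Rightarrow> nat \<Rightarrow> complex" where
  "DQ w1 w2 k = (1 - of_real (p k) * (w1 + w2 - w1 * w2))
     / ((1 - of_real (p k) * w1) * (1 - of_real (p k) * w2))"

lemma F_difference_quotient:
  assumes w1: "norm w1 \<le> 1" "w1 \<noteq> 0" and w2: "norm w2 \<le> 1" "w2 \<noteq> 0" and neq: "w1 \<noteq> w2"
  shows "(\<lambda>k. of_real (\<nu> k) * DQ w1 w2 k) sums ((F w1 - F w2) * (w1 * w2 / (w2 - w1)))"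
proof -
  have "(\<lambda>k. ((1 - w1) / w1 * (of_real (\<nu> k) * (1 / (1 - of_real (p k) * w1)))
        - (1 - w2) / w2 * (of_real (\<nu> k) * (1 / (1 - of_real (p k) * w2)))) * (w1 * w2 / (w2 - w1)))
      sums (((1 - w1) / w1 * K w1 - (1 - w2) / w2 * K w2) * (w1 * w2 / (w2 - w1)))"
    by (intro sums_mult sums_mult2 sums_diff K_partial_fractions w1 w2)
  moreover have "((1 - w1) / w1 * (of_real (\<nu> k) * (1 / (1 - of_real (p k) * w1)))
        - (1 - w2) / w2 * (of_real (\<nu> k) * (1 / (1 - of_real (p k) * w2)))) * (w1 * w2 / (w2 - w1))
      = of_real (\<nu> k) * DQ w1 w2 k" for k
  proof -
    define a b c n where "a = 1 - of_real (p k) * w1" and "b = 1 - of_real (p k) * w2"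
      and "c = w2 - w1" and "n = complex_of_real (\<nu> k)"
    have nz: "a \<noteq> 0" "b \<noteq> 0" "c \<noteq> 0"
      using norm_one_minus_p_mult(2) w1 w2 neq by (auto simp: a_def b_def c_def)
    have "((1 - w1) / w1 * (n * (1 / a)) - (1 - w2) / w2 * (n * (1 / b))) * (w1 * w2 / c)
       = n * (((1 - w1) * w2 * b - (1 - w2) * w1 * a) / (a * b * c))"
      using nz w1 w2 by (simp add: field_simps)
    also have "(1 - w1) * w2 * b - (1 - w2) * w1 * a = (1 - of_real (p k) * (w1 + w2 - w1 * w2)) * c"
      by (simp add: a_def b_def c_def algebra_simps)
    finally show ?thesis using nz unfolding DQ_def a_def[symmetric] b_def[symmetric] c_def[symmetric] n_def[symmetric] by simp
  qed
  ultimately show ?thesis by (simp add: F_def)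
qed

text \<open>For conjugate points all terms of the difference quotient are positive. Hence \<open>F\<close>, which commutes
  with conjugation, takes real values in the closed disc only on the real axis.\<close>

lemma F_cnj_neq:
  assumes "norm w \<le> 1" "w \<noteq> cnj w"
  shows "F w \<noteq> F (cnj w)"
proof
  assume eq: "F w = F (cnj w)"
  have "(\<lambda>k. of_real (\<nu> k) * DQ w (cnj w) k) sums 0"
    using F_difference_quotient[of w "cnj w"] assms eq by (cases "w = 0") auto
  moreover have "DQ w (cnj w) k = of_real ((1 - p k + p k * (norm (1 - w))\<^sup>2) / (norm (1 - of_real (p k) * w))\<^sup>2)" for k
  proof -
    have "1 - of_real (p k) * (w + cnj w - w * cnj w)
        = of_real (1 - p k) + of_real (p k) * ((1 - w) * cnj (1 - w))" by (simp add: algebra_simps)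
    moreover have "(1 - of_real (p k) * w) * (1 - of_real (p k) * cnj w)
        = (1 - of_real (p k) * w) * cnj (1 - of_real (p k) * w)" by simp
    ultimately show ?thesis unfolding DQ_def complex_norm_square[symmetric] by simp
  qed
  ultimately have "(\<lambda>k. complex_of_real (\<nu> k * ((1 - p k + p k * (norm (1 - w))\<^sup>2) / (norm (1 - of_real (p k) * w))\<^sup>2))) sums of_real 0"
    by simp
  then have "(\<lambda>k. \<nu> k * ((1 - p k + p k * (norm (1 - w))\<^sup>2) / (norm (1 - of_real (p k) * w))\<^sup>2)) sums 0"
    unfolding sums_of_real_iff .
  then have "0 < (0::real)"
  proof (rule nu_sum_pos)
    fix k
    have "0 < 1 - p k + p k * (norm (1 - w))\<^sup>2" using p_bounds[of k] by (simp add: add_pos_nonneg)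
    then show "0 < (1 - p k + p k * (norm (1 - w))\<^sup>2) / (norm (1 - of_real (p k) * w))\<^sup>2"
      using norm_one_minus_p_mult(2)[OF assms(1), of k] by simp
  qed
  then show False by simp
qed

text \<open>If \<open>\<sigma>\<close> is real the two points are conjugate and the previous lemma applies; otherwise all terms of
  the rotated difference quotient lie in one open half plane.\<close>

lemma F_inj_on_circle: "inj_on F (sphere 0 1)"
proof (rule inj_onI, rule ccontr)
  fix w1 w2 :: complex
  assume "w1 \<in> sphere 0 1" "w2 \<in> sphere 0 1" and eq: "F w1 = F w2" and neq: "w1 \<noteq> w2"
  then have n: "norm w1 = 1" "norm w2 = 1" by auto
  then have nz: "w1 \<noteq> 0" "w2 \<noteq> 0" by auto
  obtain \<sigma> \<rho> where \<sigma>: "norm \<sigma> = 1" "w1 * w2 = \<sigma>\<^sup>2" "(1 - w1) * (1 - w2) = of_real \<rho> * \<sigma>"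
    using unimodular_half_angle[OF n] by metis
  show False
  proof (cases "Im \<sigma> = 0")
    case True
    then have "\<sigma>\<^sup>2 = 1"
      using \<sigma>(1) cmod_power2[of \<sigma>] by (simp add: complex_eq_iff power2_eq_square)
    with \<sigma>(2) have "w1 * w2 = 1" by simp
    moreover have "w1 * cnj w1 = 1" using complex_norm_square[of w1] n by simp
    ultimately have "w2 = cnj w1" using nz by (metis mult_left_cancel)
    then show False using F_cnj_neq[of w1] n eq neq by auto
  next
    case False
    have "(\<lambda>k. of_real (\<nu> k) * DQ w1 w2 k) sums 0"
      using F_difference_quotient[of w1 w2] n nz neq eq by auto
    from sums_divide[OF sums_Im[OF sums_mult[OF this, of \<sigma>]], of "Im \<sigma>"]
    have "(\<lambda>k. Im (of_real (\<nu> k) * (\<sigma> * DQ w1 w2 k)) / Im \<sigma>) sums 0" by (simp add: mult_ac)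
    then have "(\<lambda>k. \<nu> k * (Im (\<sigma> * DQ w1 w2 k) / Im \<sigma>)) sums 0"
      by (simp only: Im_of_real_mult times_divide_eq_right)
    then have "0 < (0::real)"
    proof (rule nu_sum_pos)
      fix k
      \<comment> \<open>numerator and denominator of the term, written through \<open>\<sigma>\<close> and \<open>\<rho>\<close>\<close>
      define A where "A = of_real (1 - p k) + of_real (p k * \<rho>) * \<sigma>"
      define B where "B = A - of_real (p k * (1 - p k)) * \<sigma>\<^sup>2"
      have A: "A = 1 - of_real (p k) * (w1 + w2 - w1 * w2)"
      proof -
        have "A = of_real (1 - p k) + of_real (p k) * ((1 - w1) * (1 - w2))"
          unfolding A_def \<sigma>(3) by simp
        then show ?thesis by (simp add: algebra_simps)
      qed
      have B: "B = (1 - of_real (p k) * w1) * (1 - of_real (p k) * w2)"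
        unfolding B_def A \<sigma>(2)[symmetric] by (simp add: algebra_simps)
      have "Im (\<sigma> * DQ w1 w2 k) / Im \<sigma> = ((norm A)\<^sup>2 + p k * (1 - p k)\<^sup>2) / (norm B)\<^sup>2"
        using Im_rotated_quotient[OF \<sigma>(1), of "p k" \<rho>] False
        unfolding DQ_def A[symmetric] B[symmetric] A_def[symmetric] B_def[symmetric] by simp
      moreover have "B \<noteq> 0" unfolding B using norm_one_minus_p_mult(2) n by simp
      moreover have "(norm A)\<^sup>2 + p k * (1 - p k)\<^sup>2 > 0"
      proof (cases "p k = 0")
        case True
        then show ?thesis by (simp add: A_def)
      next
        case False
        then have "0 < p k * (1 - p k)\<^sup>2" using p_bounds[of k] by simp
        then show ?thesis by (simp add: add_nonneg_pos)
      qed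
      ultimately show "0 < Im (\<sigma> * DQ w1 w2 k) / Im \<sigma>" by simp
    qed
    then show False by simp
  qed
qed

end

section \<open>Trajectories\<close>

text \<open>Trajectories are determined by their initial value, so stability only concerns the one that
  starts at \<open>1\<close>.\<close>

lemma trajectory_unique:
  assumes "trajectory \<alpha> q a x" "trajectory \<alpha> q a y" "x 0 = y 0"
  shows "x t = y t"
proof (induction t rule: less_induct)
  case (less t)
  show ?case
  proof (cases t)
    case (Suc n)
    have "(\<Sum>j=0..n. of_real (phi_kernel \<alpha> q (n - j)) * x j) = (\<Sum>j=0..n. of_real (phi_kernel \<alpha> q (n - j)) * y j)"
      using less Suc by (intro sum.cong) auto
    then show ?thesis using assms unfolding trajectory_def Suc by simp
  qed (use assms in simp)
qed

lemma trajectory_scale: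
  assumes "trajectory \<alpha> q a x"
  shows "trajectory \<alpha> q a (\<lambda>t. c * x t)"
  using assms unfolding trajectory_def
  by (simp add: algebra_simps sum_distrib_left)

lemma trajectory_of_real:
  assumes "trajectory \<alpha> q a x"
  shows "trajectory \<alpha> q (of_real a :: complex) (\<lambda>t. of_real (x t))"
  unfolding trajectory_def
proof
  fix t
  have "x (t + 1) = x 0 + (a - 1) * (\<Sum>j=0..t. phi_kernel \<alpha> q (t - j) * x j)"
    using assms by (simp add: trajectory_def)
  then show "complex_of_real (x (t + 1)) = of_real (x 0)
      + (of_real a - 1) * (\<Sum>j=0..t. of_real (phi_kernel \<alpha> q (t - j)) * of_real (x j))"
    by simp
qed

lemma zero_asymp_stableI:
  fixes a :: "'a::real_normed_field"
  assumes bound: "\<And>x t. trajectory \<alpha> q a x \<Longrightarrow> norm (x t) = norm (x 0) * g t"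
    and g: "g \<longlonglongrightarrow> 0"
  shows "zero_asymp_stable \<alpha> q a"
proof -
  from g have "bounded (range g)" by (rule convergent_imp_bounded)
  then obtain M where "M > 0" and M: "\<And>t. \<bar>g t\<bar> \<le> M" unfolding bounded_pos by auto
  have "zero_stable \<alpha> q a"
    unfolding zero_stable_def
  proof (intro allI impI)
    fix e :: real assume "0 < e"
    show "\<exists>d>0. \<forall>x. trajectory \<alpha> q a x \<longrightarrow> norm (x 0) < d \<longrightarrow> (\<forall>t\<ge>1. norm (x t) < e)"
    proof (intro exI[of _ "e / M"] conjI allI impI)
      show "0 < e / M" using \<open>0 < e\<close> \<open>0 < M\<close> by simp
      fix x :: "nat \<Rightarrow> 'a" and t :: nat assume x: "trajectory \<alpha> q a x" "norm (x 0) < e / M"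
      have "norm (x t) \<le> norm (x 0) * M"
        using mult_left_mono[of "g t" M "norm (x 0)"] abs_le_D1[OF M[of t]] bound[OF x(1), of t] by simp
      also have "\<dots> < e" using x(2) \<open>0 < M\<close> by (simp add: field_simps)
      finally show "norm (x t) < e" .
    qed
  qed
  moreover have "x \<longlonglongrightarrow> 0" if "trajectory \<alpha> q a x" for x
  proof -
    have "(\<lambda>t. norm (x 0) * g t) \<longlonglongrightarrow> 0" using g by (rule tendsto_mult_right_zero)
    then show ?thesis unfolding bound[OF that, symmetric] tendsto_norm_zero_iff .
  qed
  ultimately show ?thesis unfolding zero_asymp_stable_def using zero_less_one by blast
qed

text \<open>An Abelian estimate: coefficients tending to \<open>0\<close> exclude a pole on the unit circle. Beyond an
  index \<open>N\<close> the series is dominated by a small multiple of \<open>1 / (1 - r)\<close>.\<close>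

lemma one_minus_r_times_power_series_tendsto_0:
  fixes c :: "nat \<Rightarrow> complex"
  assumes c: "c \<longlonglongrightarrow> 0" and w: "norm w = 1"
  shows "((\<lambda>r. of_real (1 - r) * (\<Sum>n. c n * (of_real r * w) ^ n)) \<longlongrightarrow> 0) (at_left 1)"
proof (rule tendstoI)
  fix e :: real assume e: "0 < e"
  then obtain N where N: "\<And>n. n \<ge> N \<Longrightarrow> norm (c n) < e / 2"
    using c unfolding LIMSEQ_iff by (metis diff_zero half_gt_zero)
  define M where "M = (\<Sum>n<N. norm (c n))"
  have "((\<lambda>r::real. (1 - r) * M) \<longlongrightarrow> (1 - 1) * M) (at_left 1)" by (intro tendsto_intros)
  then have "eventually (\<lambda>r. (1 - r) * M < e / 2) (at_left 1)"
    using e by (intro order_tendstoD) auto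
  moreover have "eventually (\<lambda>r::real. r \<in> {0<..<1}) (at_left 1)"
    by (rule eventually_at_leftI[of 0]) auto
  ultimately show "eventually (\<lambda>r. dist (of_real (1 - r) * (\<Sum>n. c n * (of_real r * w) ^ n)) 0 < e) (at_left 1)"
  proof eventually_elim
    case (elim r)
    have geo: "(\<lambda>n. e / 2 * r ^ n) sums (e / 2 * (1 / (1 - r)))"
      using elim by (intro sums_mult geometric_sums) auto
    have fin: "(\<lambda>n. if n \<in> {..<N} then norm (c n) else 0) sums M"
      unfolding M_def by (rule sums_If_finite_set) auto
    have bnd: "norm (c n * (of_real r * w) ^ n) \<le> (if n \<in> {..<N} then norm (c n) else 0) + e / 2 * r ^ n" for n
    proof -
      have nrm: "norm (c n * (of_real r * w) ^ n) = norm (c n) * r ^ n"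
        using elim w by (simp add: norm_mult norm_power)
      show ?thesis
      proof (cases "n < N")
        case True
        have "norm (c n) * r ^ n \<le> norm (c n)" using elim by (intro mult_left_le power_le_one) auto
        moreover have "0 \<le> e / 2 * r ^ n" using elim e by simp
        ultimately show ?thesis unfolding nrm using True by simp
      next
        case False
        then show ?thesis unfolding nrm using N[of n] elim by (simp add: mult_right_mono less_imp_le)
      qed
    qed
    have "norm (\<Sum>n. c n * (of_real r * w) ^ n) \<le> M + e / 2 * (1 / (1 - r))"
      using norm_suminf_le[OF bnd sums_summable[OF sums_add[OF fin geo]]] sums_unique[OF sums_add[OF fin geo]]
      by simp
    then have "(1 - r) * norm (\<Sum>n. c n * (of_real r * w) ^ n) \<le> (1 - r) * (M + e / 2 * (1 / (1 - r)))"
      using elim by (intro mult_left_mono) auto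
    also have "\<dots> = (1 - r) * M + e / 2" using elim by (simp add: field_simps)
    also have "\<dots> < e" using elim by simp
    finally show ?case using elim by (simp add: norm_mult del: of_real_diff)
  qed
qed

section \<open>The characteristic function decides stability\<close>

context fractional_q begin

text \<open>The characteristic function of the map. Its zeros in the closed unit disc are the poles there of the
  generating function of a nonzero trajectory.\<close>

definition char_fun :: "complex \<Rightarrow> complex \<Rightarrow> complex" where
  "char_fun a w = (1 - w) * K w - (a - 1) * w"

definition char_fps :: "complex \<Rightarrow> complex fps" where
  "char_fps a = (1 - fps_X) * K_fps - fps_const (a - 1) * fps_X"

text \<open>The generating function of the trajectory that starts at \<open>1\<close>.\<close>

definition unit_fps :: "complex \<Rightarrow> complex fps" where
  "unit_fps a = K_fps / char_fps a"

lemma char_fps_0: "fps_nth (char_fps a) 0 = 1"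
  by (simp add: char_fps_def K_fps_def h_0)

lemma unit_fps_times_char_fps: "unit_fps a * char_fps a = K_fps"
  unfolding unit_fps_def using char_fps_0[of a] by (simp add: fps_divide_unit mult.assoc inverse_mult_eq_1)

text \<open>Multiplying \<open>unit_fps a * char_fps a = K_fps\<close> by the generating function \<open>\<Phi>\<close> of the kernel and using
  \<open>(1 - w) K \<Phi> = 1\<close> turns the characteristic function into \<open>1 - (a - 1) w \<Phi>\<close> and the right-hand side
  into \<open>1 / (1 - w)\<close>, whose coefficients are all \<open>1\<close>. Comparing coefficients gives the map.\<close>

lemma unit_fps_recursion:
  "fps_nth (unit_fps a) 0 = 1"
  "fps_nth (unit_fps a) (Suc t)
    = 1 + (a - 1) * (\<Sum>j=0..t. of_real (\<phi> (t - j)) * fps_nth (unit_fps a) j)"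
proof -
  define c where "c = unit_fps a"
  define Y where "Y = c - fps_const (a - 1) * (fps_X * (c * \<Phi>_fps))"
  have "char_fps a * \<Phi>_fps = 1 - fps_const (a - 1) * fps_X * \<Phi>_fps"
    using left_diff_distrib[of "(1 - fps_X) * K_fps" "fps_const (a - 1) * fps_X" \<Phi>_fps]
    unfolding char_fps_def K_times_Phi .
  then have "c * (1 - fps_const (a - 1) * fps_X * \<Phi>_fps) = K_fps * \<Phi>_fps"
    unfolding c_def unit_fps_times_char_fps[of a, symmetric] by (simp only: mult.assoc)
  then have "Y = K_fps * \<Phi>_fps" unfolding Y_def by (simp add: algebra_simps)
  then have "(1 - fps_X) * Y = 1" using K_times_Phi by (simp add: mult.assoc)
  then have "fps_nth (Y - fps_X * Y) n = fps_nth 1 n" for n by (simp only: left_diff_distrib mult_1)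
  then have step: "fps_nth Y n - (if n = 0 then 0 else fps_nth Y (n - 1)) = fps_nth 1 n" for n
    by (simp only: fps_sub_nth fps_X_mult_nth)
  have Y: "fps_nth Y n = 1" for n
  proof (induction n)
    case 0 show ?case using step[of 0] by simp
  next
    case (Suc n) then show ?case using step[of "Suc n"] by simp
  qed
  show "fps_nth (unit_fps a) 0 = 1"
    using Y[of 0] unfolding Y_def c_def by simp
  have "(\<Sum>j=0..t. of_real (\<phi> (t - j)) * fps_nth c j) = fps_nth (c * \<Phi>_fps) t"
    by (simp add: fps_mult_nth \<Phi>_fps_def mult.commute)
  then show "fps_nth (unit_fps a) (Suc t)
    = 1 + (a - 1) * (\<Sum>j=0..t. of_real (\<phi> (t - j)) * fps_nth (unit_fps a) j)"
    using Y[of "Suc t"] unfolding Y_def c_def by (simp add: diff_eq_eq)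
qed

lemma trajectory_unit: "trajectory \<alpha> q a (fps_nth (unit_fps a))"
  unfolding trajectory_def by (simp add: unit_fps_recursion)

lemma trajectory_eq:
  assumes "trajectory \<alpha> q a x"
  shows "x t = x 0 * fps_nth (unit_fps a) t"
  using trajectory_unique[OF assms trajectory_scale[OF trajectory_unit, where c = "x 0"], of t]
  by (simp add: unit_fps_recursion)

lemma zero_asymp_stable_iff:
  "zero_asymp_stable \<alpha> q a \<longleftrightarrow> fps_nth (unit_fps a) \<longlonglongrightarrow> 0"
proof
  assume lim: "fps_nth (unit_fps a) \<longlonglongrightarrow> 0"
  show "zero_asymp_stable \<alpha> q a"
  proof (rule zero_asymp_stableI)
    show "(\<lambda>t. norm (fps_nth (unit_fps a) t)) \<longlonglongrightarrow> 0"
      using lim by (rule tendsto_norm_zero)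
    show "norm (x t) = norm (x 0) * norm (fps_nth (unit_fps a) t)"
      if "trajectory \<alpha> q a x" for x t
      using trajectory_eq[OF that, of t] by (simp add: norm_mult)
  qed
next
  assume "zero_asymp_stable \<alpha> q a"
  then obtain d where "d > 0" and d: "\<And>x. trajectory \<alpha> q a x \<Longrightarrow> norm (x 0) < d \<Longrightarrow> x \<longlonglongrightarrow> 0"
    unfolding zero_asymp_stable_def by blast
  have "(\<lambda>t. of_real (d / 2) * fps_nth (unit_fps a) t) \<longlonglongrightarrow> 0"
    using \<open>d > 0\<close> by (intro d trajectory_scale trajectory_unit) (simp add: unit_fps_recursion)
  from tendsto_mult_left[OF this, of "of_real (2 / d)"]
  show "fps_nth (unit_fps a) \<longlonglongrightarrow> 0" using \<open>d > 0\<close> by simp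
qed

lemma zero_asymp_stable_real:
  fixes a :: real
  assumes "fps_nth (unit_fps (of_real a)) \<longlonglongrightarrow> 0"
  shows "zero_asymp_stable \<alpha> q a"
proof (rule zero_asymp_stableI)
  show "(\<lambda>t. norm (fps_nth (unit_fps (of_real a)) t)) \<longlonglongrightarrow> 0"
    using assms by (rule tendsto_norm_zero)
  fix x t assume "trajectory \<alpha> q a x"
  from arg_cong[OF trajectory_eq[OF trajectory_of_real[OF this], of t], of norm]
  show "norm (x t) = norm (x 0) * norm (fps_nth (unit_fps (of_real a)) t)"
    by (simp add: norm_mult)
qed

lemma char_fun_has_fps_expansion: "char_fun a has_fps_expansion char_fps a"
  unfolding char_fun_def char_fps_def K_def
  using less_le_trans[OF _ conv_radius_K, of 0] R_gt_1
  by (intro has_fps_expansion_mult has_fps_expansion_diff has_fps_expansion_1 has_fps_expansion_const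
        has_fps_expansion_fps_X eval_fps_has_fps_expansion) auto

lemma char_fun_holomorphic: "char_fun a holomorphic_on ball 0 R"
  unfolding char_fun_def by (intro holomorphic_intros K_holomorphic)

text \<open>By compactness the characteristic function has no zeros in a disc of radius greater than \<open>1\<close>, so
  the generating function converges at \<open>1\<close>.\<close>

lemma unit_fps_tendsto_0:
  assumes nz: "\<And>w. norm w \<le> 1 \<Longrightarrow> char_fun a w \<noteq> 0"
  shows "fps_nth (unit_fps a) \<longlonglongrightarrow> 0"
proof -
  define U where "U = {w \<in> ball 0 R. char_fun a w \<noteq> 0}"
  have "open U"
  proof -
    have "open (ball 0 R \<inter> char_fun a -` (- {0}))"
      by (intro continuous_open_preimage holomorphic_on_imp_continuous_on char_fun_holomorphic) auto
    also have "ball 0 R \<inter> char_fun a -` (- {0}) = U" unfolding U_def by blast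
    finally show ?thesis .
  qed
  moreover have "cball 0 1 \<subseteq> U" using nz R_gt_1 by (auto simp: U_def)
  ultimately obtain e where "e > 0" and e: "(\<Union>w\<in>cball 0 1. ball w e) \<subseteq> U"
    using compact_subset_open_imp_ball_epsilon_subset[of "cball 0 1" U] by auto
  have in_U: "ball 0 (1 + e) \<subseteq> U"
  proof
    fix w :: complex assume w: "w \<in> ball 0 (1 + e)"
    show "w \<in> U"
    proof (cases "norm w \<le> 1")
      case True then show ?thesis using \<open>cball 0 1 \<subseteq> U\<close> by auto
    next
      case False
      then have "w \<noteq> 0" by auto
      \<comment> \<open>\<open>sgn w\<close> is the point of the closed unit disc nearest to \<open>w\<close>\<close>
      then have "sgn w - w = of_real (1 - norm w) * sgn w"
        by (simp add: sgn_eq field_simps)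
      moreover have sgn: "norm (sgn w) = 1" using \<open>w \<noteq> 0\<close> by (simp add: norm_sgn)
      ultimately have "dist (sgn w) w = \<bar>1 - norm w\<bar>"
        unfolding dist_norm by (simp only: norm_mult norm_of_real mult_1_right)
      then have "w \<in> ball (sgn w) e" using w False by simp
      moreover have "sgn w \<in> cball 0 1" using sgn by simp
      ultimately show ?thesis using e by blast
    qed
  qed
  then have sub: "ball (0::complex) (1 + e) \<subseteq> ball 0 R" unfolding U_def by blast
  have "char_fun a w \<noteq> 0" if "w \<in> ball 0 (1 + e)" for w
    using subsetD[OF in_U that] unfolding U_def by blast
  then have hol: "(\<lambda>w. K w / char_fun a w) holomorphic_on ball 0 (1 + e)"
    by (intro holomorphic_on_divide holomorphic_on_subset[OF K_holomorphic sub]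
        holomorphic_on_subset[OF char_fun_holomorphic sub])
  have "(\<lambda>w. K w / char_fun a w) has_fps_expansion unit_fps a"
    unfolding unit_fps_def
  proof (rule has_fps_expansion_divide')
    show "K has_fps_expansion K_fps"
      unfolding K_def using less_le_trans[OF _ conv_radius_K, of 0] R_gt_1
      by (intro eval_fps_has_fps_expansion) simp
  qed (simp_all add: char_fun_has_fps_expansion char_fps_0)
  then have "fps_expansion (\<lambda>w. K w / char_fun a w) 0 = unit_fps a" by (rule fps_expansion_eqI)
  then have "fps_conv_radius (unit_fps a) \<ge> ereal (1 + e)"
    using conv_radius_fps_expansion[of "\<lambda>w. K w / char_fun a w" 0 "ereal (1 + e)"] hol by simp
  then have "norm (1::complex) < fps_conv_radius (unit_fps a)"
    by (rule less_le_trans[of _ "ereal (1 + e)", rotated]) (use \<open>e > 0\<close> in simp)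
  from summable_LIMSEQ_zero[OF summable_fps[OF this]] show ?thesis by simp
qed

text \<open>The numerator \<open>K\<close> of the generating function does not vanish in the closed disc, so a zero of the
  characteristic function is a genuine pole. Inside the disc this contradicts convergence; on the
  circle it contradicts the Abelian estimate, as \<open>char_fun a\<close> vanishes there to first order at least.\<close>

lemma unit_fps_tendsto_0_imp_char_fun_nonzero:
  assumes c: "fps_nth (unit_fps a) \<longlonglongrightarrow> 0" and w: "norm w \<le> 1"
  shows "char_fun a w \<noteq> 0"
proof
  assume zero: "char_fun a w = 0"
  define X where "X = eval_fps (unit_fps a)"
  have bdd: "Bseq (fps_nth (unit_fps a))" using c by (intro convergent_imp_Bseq convergentI)
  have rad: "fps_conv_radius (unit_fps a) \<ge> 1"
    unfolding fps_conv_radius_def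
  proof (rule conv_radius_geI_ex')
    fix r :: real assume r: "0 < r" "ereal r < 1"
    obtain M where M: "\<And>n. norm (fps_nth (unit_fps a) n) \<le> M" using bdd unfolding Bseq_def by blast
    have "summable (\<lambda>n. M * r ^ n)" using r by (intro summable_mult summable_geometric) auto
    then show "summable (\<lambda>n. fps_nth (unit_fps a) n * of_real r ^ n)"
      by (rule summable_comparison_test'[where N = 0])
         (use M r in \<open>auto simp: norm_mult norm_power intro!: mult_right_mono\<close>)
  qed
  have K_eq: "K z = X z * char_fun a z" if "norm z < 1" for z
  proof -
    have r1: "ereal (norm z) < fps_conv_radius (unit_fps a)"
      by (rule less_le_trans[OF _ rad]) (use that in simp)
    have rK: "ereal (norm z) < fps_conv_radius K_fps"
      by (rule less_le_trans[OF _ conv_radius_K]) (use that R_gt_1 in simp)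
    have r1X: "ereal (norm z) < fps_conv_radius (1 - fps_X :: complex fps)"
      by (rule less_le_trans[OF _ fps_conv_radius_diff]) simp
    have r2: "ereal (norm z) < fps_conv_radius ((1 - fps_X) * K_fps)"
      by (rule less_le_trans[OF _ fps_conv_radius_mult]) (use r1X rK in simp)
    have r3: "ereal (norm z) < fps_conv_radius (fps_const (a - 1) * fps_X)"
      by (rule less_le_trans[OF _ fps_conv_radius_mult]) simp
    have r4: "ereal (norm z) < fps_conv_radius (char_fps a)"
      unfolding char_fps_def by (rule less_le_trans[OF _ fps_conv_radius_diff]) (use r2 r3 in simp)
    have "eval_fps (char_fps a) z = char_fun a z"
      unfolding char_fps_def char_fun_def K_def using r1X rK r2 r3
      by (simp add: eval_fps_diff eval_fps_mult)
    then show ?thesis unfolding X_def K_def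
      unfolding unit_fps_times_char_fps[of a, symmetric] using eval_fps_mult[OF r1 r4] by simp
  qed
  show False
  proof (cases "norm w < 1")
    case True
    then show False using K_eq[of w] zero K_nonzero[of w] by simp
  next
    case False
    then have w1: "norm w = 1" using w by simp
    then have "w \<noteq> 0" by auto
    obtain d where "(char_fun a has_field_derivative d) (at w)"
      using holomorphic_derivI[OF char_fun_holomorphic open_ball, of w] w1 R_gt_1 by auto
    then have quot: "((\<lambda>z. char_fun a z / (z - w)) \<longlongrightarrow> d) (at w)"
      using zero by (simp add: has_field_derivative_iff)
    have radial: "((\<lambda>r. of_real r * w) \<longlongrightarrow> w) (at_left 1)"
      by (rule tendsto_eq_intros | simp)+
    have ev: "eventually (\<lambda>r::real. r \<in> {0<..<1}) (at_left 1)"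
      by (rule eventually_at_leftI[of 0]) auto
    have "filterlim (\<lambda>r. of_real r * w) (at w) (at_left 1)"
      unfolding filterlim_at using radial ev \<open>w \<noteq> 0\<close> by (auto elim!: eventually_mono)
    from filterlim_compose[OF quot this]
    have lim1: "((\<lambda>r. char_fun a (of_real r * w) / (of_real r * w - w)) \<longlongrightarrow> d) (at_left 1)" .
    have lim2: "((\<lambda>r. of_real (1 - r) * X (of_real r * w)) \<longlongrightarrow> 0) (at_left 1)"
      unfolding X_def eval_fps_def by (rule one_minus_r_times_power_series_tendsto_0[OF c w1])
    \<comment> \<open>the blow-up of \<open>X\<close> is paired with the first-order zero of \<open>char_fun a\<close>\<close>
    have "((\<lambda>r. - w * ((of_real (1 - r) * X (of_real r * w)) * (char_fun a (of_real r * w) / (of_real r * w - w))))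
        \<longlongrightarrow> - w * (0 * d)) (at_left 1)"
      by (intro tendsto_intros lim1 lim2)
    moreover have ev_K: "eventually (\<lambda>r. - w * ((of_real (1 - r) * X (of_real r * w)) * (char_fun a (of_real r * w) / (of_real r * w - w)))
        = K (of_real r * w)) (at_left 1)"
      using ev
    proof eventually_elim
      case (elim r)
      have "K (of_real r * w) = X (of_real r * w) * char_fun a (of_real r * w)"
        using elim w1 by (intro K_eq) (simp add: norm_mult)
      moreover have "of_real r * w - w = - w * of_real (1 - r)" by (simp add: algebra_simps)
      moreover have "complex_of_real (1 - r) \<noteq> 0" using elim by (simp del: of_real_diff)
      ultimately show ?case using \<open>w \<noteq> 0\<close> by (simp del: of_real_diff)
    qed
    ultimately have "((\<lambda>r. K (of_real r * w)) \<longlongrightarrow> 0) (at_left 1)"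
      using Lim_transform_eventually[OF _ ev_K] by simp
    moreover have "isCont K w"
      using K_holomorphic w1 R_gt_1 holomorphic_on_imp_continuous_on[of K "ball 0 R"]
      by (simp add: continuous_on_eq_continuous_at)
    then have "((\<lambda>r. K (of_real r * w)) \<longlongrightarrow> K w) (at_left 1)"
      by (rule isCont_tendsto_compose[OF _ radial])
    ultimately have "K w = 0" using tendsto_unique[OF trivial_limit_at_left_real] by blast
    then show False using K_nonzero[OF w] by simp
  qed
qed

lemma stability_region_eq: "stability_region \<alpha> q = {a. \<forall>w. norm w \<le> 1 \<longrightarrow> char_fun a w \<noteq> 0}"
  unfolding stability_region_def zero_asymp_stable_iff
  using unit_fps_tendsto_0 unit_fps_tendsto_0_imp_char_fun_nonzero by blast

end

section \<open>The boundary curve\<close>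

context fractional_q begin

lemma char_fun_eq: "w \<noteq> 0 \<Longrightarrow> char_fun a w = w * (F w - (a - 1))"
  by (simp add: char_fun_def F_def field_simps)

lemma char_fun_at_0: "char_fun a 0 = 1" by (simp add: char_fun_def K_0)

lemma F_at_minus_1: "F (-1) = - of_real (Lambda q \<alpha>)"
proof -
  have q: "norm q < 1" using q_nonneg q_less by simp
  have "complex_of_real (Lambda q \<alpha>) = qpoch_inf (- 1) (of_real q) / qpoch_inf (of_real P * (- 1)) (of_real q)"
    unfolding Lambda_def P_def[symmetric] of_real_divide of_real_qpoch_inf[OF q] by simp
  also have "\<dots> = (1 - (- 1)) * K (- 1)" by (rule q_pochhammer_quotient) simp
  finally show ?thesis by (simp add: F_def)
qed

lemma Lambda_pos: "0 < Lambda q \<alpha>"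
proof -
  have "Re (F (-1)) = - 2 * Re (K (-1))" by (simp add: F_def)
  then show ?thesis using Re_K_pos[of "-1"] unfolding F_at_minus_1 by simp
qed

lemma K_cnj:
  assumes "norm w \<le> 1"
  shows "K (cnj w) = cnj (K w)"
proof -
  have "(\<lambda>k. cnj (of_real (\<nu> k) * (1 / (1 - of_real (p k) * w)))) sums cnj (K w)"
    unfolding sums_cnj by (rule K_partial_fractions[OF assms])
  moreover have "(\<lambda>k. of_real (\<nu> k) * (1 / (1 - of_real (p k) * cnj w))) sums K (cnj w)"
    using assms by (intro K_partial_fractions) simp
  ultimately show ?thesis by (simp add: sums_unique2)
qed

text \<open>On the negative axis the terms of the difference quotient with \<open>- 1\<close> are positive.\<close>

lemma F_less_at_minus_1:
  fixes r :: real
  assumes r: "-1 < r" "r < 0"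
  shows "Re (F (of_real r)) < - Lambda q \<alpha>"
proof -
  define z where "z = F (of_real r) - F (-1)"
  have neq: "complex_of_real r \<noteq> - 1"
    using r by (metis of_real_1 of_real_eq_iff of_real_minus less_irrefl)
  have eq: "of_real r * (- 1) / (- 1 - of_real r) = complex_of_real (r / (1 + r))"
  proof -
    have "- 1 - complex_of_real r = - (1 + of_real r)" by simp
    then show ?thesis unfolding mult_minus1_right by (simp only: minus_divide_divide) simp
  qed
  have "(\<lambda>k. of_real (\<nu> k) * DQ (of_real r) (-1) k) sums (z * of_real (r / (1 + r)))"
    unfolding z_def eq[symmetric] using r neq by (intro F_difference_quotient) auto
  moreover have "DQ (of_real r) (-1) k = of_real ((1 - p k * (2 * r - 1)) / ((1 - p k * r) * (1 + p k)))" for k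
    by (simp add: DQ_def)
  ultimately have "(\<lambda>k. complex_of_real (\<nu> k * ((1 - p k * (2 * r - 1)) / ((1 - p k * r) * (1 + p k)))))
      sums (of_real (r / (1 + r)) * z)"
    by (simp add: mult.commute)
  from sums_Re[OF this]
  have "(\<lambda>k. \<nu> k * ((1 - p k * (2 * r - 1)) / ((1 - p k * r) * (1 + p k)))) sums (r / (1 + r) * Re z)"
    by (simp only: Re_complex_of_real Re_of_real_mult)
  then have "0 < r / (1 + r) * Re z"
  proof (rule nu_sum_pos)
    fix k
    have "p k * r \<le> 0" using p_bounds[of k] r by (simp add: mult_le_0_iff)
    then show "0 < (1 - p k * (2 * r - 1)) / ((1 - p k * r) * (1 + p k))"
      using p_bounds[of k] by (intro divide_pos_pos mult_pos_pos) (auto simp: algebra_simps)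
  qed
  then have "Re z < 0" using r by (simp add: zero_less_mult_iff zero_less_divide_iff)
  then show ?thesis by (simp add: z_def F_at_minus_1)
qed

text \<open>The symbol is real only on the real axis, where it is nonnegative on \<open>(0, 1]\<close> and at most
  \<open>- Lambda\<close> on \<open>[- 1, 0)\<close>; so it omits the values \<open>a - 1\<close> of the interval.\<close>

lemma char_fun_real_nonzero:
  fixes a :: real
  assumes a: "1 - Lambda q \<alpha> < a" "a < 1" and w: "norm w \<le> 1"
  shows "char_fun (of_real a) w \<noteq> 0"
proof
  assume zero: "char_fun (of_real a) w = 0"
  then have "w \<noteq> 0" using char_fun_at_0 by auto
  with zero have Fw: "F w = of_real (a - 1)" by (simp add: char_fun_eq)
  have "F (cnj w) = cnj (F w)" by (simp add: F_def K_cnj[OF w])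
  then have "F w = F (cnj w)" unfolding Fw by simp
  with F_cnj_neq[OF w] have "w = cnj w" by blast
  then have "w \<in> \<real>" by (simp add: Reals_cnj_iff)
  then obtain r where r: "w = of_real r" by (auto elim: Reals_cases)
  have r1: "-1 \<le> r" "r \<le> 1" "r \<noteq> 0" using w \<open>w \<noteq> 0\<close> unfolding r by auto
  have ReF: "Re (F w) = a - 1" by (simp add: Fw)
  consider "r > 0" | "r = -1" | "-1 < r" "r < 0" using r1 by linarith
  then show False
  proof cases
    case 1
    have "F w = of_real ((1 - r) / r) * K w" unfolding r F_def by simp
    then have "Re (F w) = (1 - r) / r * Re (K w)" by (simp only: Re_of_real_mult)
    then have "0 \<le> Re (F w)" using 1 r1 Re_K_pos[OF w] by simp
    then show False using ReF a by simp
  next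
    case 2
    then show False using ReF a F_at_minus_1 r by simp
  next
    case 3
    then show False using ReF a F_less_at_minus_1[of r] r by simp
  qed
qed

text \<open>The curve uses \<open>w = exp (- \<i> \<theta>)\<close>, which runs through the circle clockwise.\<close>

lemma gamma_path_eq: "gamma_path \<alpha> q = (\<lambda>w. 1 + F w) \<circ> reversepath (circlepath 0 1)"
proof
  fix t :: real
  define w where "w = exp (- \<i> * of_real (2 * pi * t))"
  have w: "norm w = 1" by (simp add: w_def)
  have "exp (\<i> * of_real (2 * pi * t)) * w = 1"
    unfolding w_def by (simp flip: exp_add)
  then have inv: "exp (\<i> * of_real (2 * pi * t)) = 1 / w" using w by (metis eq_divide_eq norm_zero zero_neq_one)
  have "gamma_path \<alpha> q t = 1 + 1 / w * (qpoch_inf w (of_real q) / qpoch_inf (of_real P * w) (of_real q))"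
    unfolding gamma_path_def gamma_curve_def inv w_def[symmetric] P_def[symmetric] by simp
  also have "\<dots> = 1 + F w"
    using w by (subst q_pochhammer_quotient) (auto simp: F_def)
  also have "w = reversepath (circlepath 0 1) t"
  proof -
    have "reversepath (circlepath 0 1) t = exp (2 * of_real pi * \<i> + (- \<i> * of_real (2 * pi * t)))"
      by (simp add: reversepath_def circlepath algebra_simps)
    also have "\<dots> = w" unfolding exp_add exp_two_pi_i w_def by simp
    finally show ?thesis ..
  qed
  finally show "gamma_path \<alpha> q t = ((\<lambda>w. 1 + F w) \<circ> reversepath (circlepath 0 1)) t" by simp
qed

lemma F_holomorphic: "F holomorphic_on ball 0 R - {0}"
  unfolding F_def
  by (intro holomorphic_intros holomorphic_on_subset[OF K_holomorphic]) auto

lemma sphere_subset: "sphere 0 1 \<subseteq> ball (0::complex) R - {0}"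
  using R_gt_1 by auto

lemma path_image_gamma: "path_image (gamma_path \<alpha> q) = (\<lambda>w. 1 + F w) ` sphere 0 1"
  unfolding gamma_path_eq by (simp add: path_image_compose)

lemma simple_path_gamma: "simple_path (gamma_path \<alpha> q)"
  unfolding gamma_path_eq
proof (rule simple_path_continuous_image)
  show "simple_path (reversepath (circlepath (0::complex) 1))"
    by (simp add: simple_path_reversepath simple_path_circlepath)
  show "continuous_on (path_image (reversepath (circlepath 0 1))) (\<lambda>w. 1 + F w)"
    using continuous_on_subset[OF holomorphic_on_imp_continuous_on[OF F_holomorphic] sphere_subset]
    by (auto intro: continuous_intros)
  show "inj_on (\<lambda>w. 1 + F w) (path_image (reversepath (circlepath 0 1)))"
    using F_inj_on_circle by (simp add: inj_on_def)
qed

lemma gamma_closed: "pathfinish (gamma_path \<alpha> q) = pathstart (gamma_path \<alpha> q)"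
  unfolding gamma_path_eq by (simp add: pathfinish_compose pathstart_compose)

lemma stability_region_complement:
  "- stability_region \<alpha> q = path_image (gamma_path \<alpha> q) \<union> (\<lambda>w. 1 + F w) ` (ball 0 1 - {0})"
proof -
  have "char_fun a w = 0 \<longleftrightarrow> w \<noteq> 0 \<and> a = 1 + F w" for a w
    using char_fun_eq[of w a] char_fun_at_0[of a] by (cases "w = 0") auto
  then have "- stability_region \<alpha> q = (\<lambda>w. 1 + F w) ` (cball 0 1 - {0})"
    unfolding stability_region_eq by auto
  also have "cball 0 1 - {0} = sphere 0 1 \<union> (ball 0 1 - {0::complex})"
    by auto
  finally show ?thesis unfolding path_image_gamma by (simp add: image_Un)
qed

text \<open>The characteristic function depends on \<open>a\<close> only through \<open>(a - 1) w\<close>, so a parameter change smaller than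
  its minimum modulus on the closed disc creates no zero.\<close>

lemma open_stability_region: "open (stability_region \<alpha> q)"
  unfolding open_dist
proof
  fix a assume "a \<in> stability_region \<alpha> q"
  then have nz: "char_fun a w \<noteq> 0" if "norm w \<le> 1" for w using that by (auto simp: stability_region_eq)
  have "cball 0 1 \<subseteq> ball (0::complex) R" using R_gt_1 by auto
  then have "continuous_on (cball 0 1) (\<lambda>w. norm (char_fun a w))"
    by (intro continuous_intros holomorphic_on_imp_continuous_on holomorphic_on_subset[OF char_fun_holomorphic])
  then obtain w0 where w0: "w0 \<in> cball 0 1" "\<And>w. w \<in> cball 0 1 \<Longrightarrow> norm (char_fun a w0) \<le> norm (char_fun a w)"
    using continuous_attains_inf[of "cball 0 1" "\<lambda>w. norm (char_fun a w)"] by auto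
  show "\<exists>e>0. \<forall>b. dist b a < e \<longrightarrow> b \<in> stability_region \<alpha> q"
  proof (intro exI[of _ "norm (char_fun a w0)"] conjI allI impI)
    show "0 < norm (char_fun a w0)" using nz[of w0] w0(1) by simp
    fix b assume b: "dist b a < norm (char_fun a w0)"
    have "char_fun b w \<noteq> 0" if "norm w \<le> 1" for w
    proof
      assume "char_fun b w = 0"
      then have "char_fun a w = (b - a) * w" by (simp add: char_fun_def algebra_simps)
      then have "norm (char_fun a w) \<le> norm (b - a)"
        using that by (simp add: norm_mult mult_left_le)
      then show False using b w0(2)[of w] that by (simp add: dist_norm)
    qed
    then show "b \<in> stability_region \<alpha> q" by (simp add: stability_region_eq)
  qed
qed

lemma open_image_punctured_disc: "open ((\<lambda>w. 1 + F w) ` (ball 0 1 - {0}))"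
proof (rule open_mapping_thm[where S = "ball 0 1 - {0}"])
  show "(\<lambda>w. 1 + F w) holomorphic_on ball 0 1 - {0}"
    using R_gt_1 by (intro holomorphic_intros holomorphic_on_subset[OF F_holomorphic]) auto
  show "connected (ball (0::complex) 1 - {0})" by (intro connected_punctured_ball) simp
  show "\<not> (\<lambda>w. 1 + F w) constant_on ball 0 1 - {0}"
  proof
    assume "(\<lambda>w. 1 + F w) constant_on ball 0 1 - {0}"
    then obtain c where c: "\<And>w. w \<in> ball 0 1 - {0} \<Longrightarrow> 1 + F w = c"
      unfolding constant_on_def by blast
    have "1 + F (1 / 2) = c" "1 + F (- 1 / 2) = c" by (intro c; simp)+
    then have "F (1 / 2) = F (- 1 / 2)" by (metis add_left_cancel)
    moreover have "F (1 / 2) = K (1 / 2)" "F (- 1 / 2) = - 3 * K (- 1 / 2)" by (simp_all add: F_def)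
    ultimately show False using Re_K_pos[of "1 / 2"] Re_K_pos[of "- 1 / 2"] by simp
  qed
qed (auto intro!: open_delete)

text \<open>A zero-free characteristic function has a continuous logarithm \<open>L\<close> on the disc. Since
  \<open>1 + F w - a = char_fun a w / w\<close>, a logarithm of the curve minus \<open>a\<close> is \<open>L\<close> plus \<open>2 \<pi> \<i> t\<close>: the term with \<open>L\<close>
  returns to its start, and the other one, caused by the pole of the symbol at \<open>0\<close>, turns once.\<close>

lemma winding_number_gamma:
  assumes a: "a \<in> stability_region \<alpha> q"
  shows "winding_number (gamma_path \<alpha> q) a = 1"
proof -
  have "cball 0 1 \<subseteq> ball (0::complex) R" using R_gt_1 by auto
  then have "continuous_on (cball 0 1) (char_fun a)"
    by (intro holomorphic_on_imp_continuous_on holomorphic_on_subset[OF char_fun_holomorphic])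
  then obtain L where L: "continuous_on (cball 0 1) L" "\<And>w. w \<in> cball 0 1 \<Longrightarrow> char_fun a w = exp (L w)"
    using continuous_logarithm_on_cball[of 0 1 "char_fun a"] a by (auto simp: stability_region_eq)
  define c where "c = reversepath (circlepath (0::complex) 1)"
  define g where "g = (\<lambda>t. L (c t) + 2 * of_real pi * \<i> * of_real t)"
  have c_eq: "c t = exp (2 * of_real pi * \<i> * of_real (1 - t))" for t
    by (simp add: c_def reversepath_def circlepath)
  have c_norm: "norm (c t) = 1" for t unfolding c_eq by (simp del: of_real_diff)
  have "path g"
    unfolding path_def g_def
  proof (intro continuous_intros continuous_on_compose2[OF L(1)])
    show "continuous_on {0..1} c" unfolding c_eq by (intro continuous_intros)
    show "c ` {0..1} \<subseteq> cball 0 1" using c_norm by auto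
  qed
  have "(\<lambda>t. gamma_path \<alpha> q t - a) = exp \<circ> g"
  proof
    fix t
    have "exp (2 * of_real pi * \<i> * of_real t) * c t = exp (2 * of_real pi * \<i> * of_real t + 2 * of_real pi * \<i> * of_real (1 - t))"
      unfolding c_eq exp_add ..
    also have "\<dots> = 1" by (simp add: algebra_simps)
    finally have inv: "exp (2 * of_real pi * \<i> * of_real t) * c t = 1" .
    have "c t \<noteq> 0" using c_norm[of t] by auto
    have "(exp \<circ> g) t = char_fun a (c t) * exp (2 * of_real pi * \<i> * of_real t)"
      unfolding g_def using L(2)[of "c t"] c_norm[of t] by (simp add: exp_add)
    also have "\<dots> = (F (c t) - (a - 1)) * (exp (2 * of_real pi * \<i> * of_real t) * c t)"
      unfolding char_fun_eq[OF \<open>c t \<noteq> 0\<close>] by (simp only: mult_ac)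
    also have "\<dots> = gamma_path \<alpha> q t - a"
      unfolding inv gamma_path_eq c_def[symmetric] by simp
    finally show "gamma_path \<alpha> q t - a = (exp \<circ> g) t" ..
  qed
  then have "winding_number (gamma_path \<alpha> q) a = winding_number (exp \<circ> g) 0"
    using winding_number_offset[of "gamma_path \<alpha> q" a] by simp
  also have "\<dots> = (pathfinish g - pathstart g) / (2 * of_real pi * \<i>)"
    by (rule winding_number_compose_exp[OF \<open>path g\<close>])
  also have "pathfinish g - pathstart g = 2 * of_real pi * \<i>"
    by (simp add: pathfinish_def pathstart_def g_def c_eq)
  finally show ?thesis by simp
qed

text \<open>The winding number puts the stability region inside the curve. Conversely the inside is
  connected and covered by two disjoint open sets, the stability region and the image of the punctured
  open disc; the first one meets it, so it is all of it.\<close>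

lemma stability_region_eq_inside: "stability_region \<alpha> q = inside (path_image (gamma_path \<alpha> q))"
proof
  let ?\<Gamma> = "path_image (gamma_path \<alpha> q)"
  let ?T = "(\<lambda>w. 1 + F w) ` (ball 0 1 - {0})"
  show sub: "stability_region \<alpha> q \<subseteq> inside ?\<Gamma>"
  proof
    fix a assume a: "a \<in> stability_region \<alpha> q"
    then have "a \<notin> outside ?\<Gamma>"
      using winding_number_gamma[OF a] winding_number_zero_in_outside[of "gamma_path \<alpha> q" a]
        simple_path_gamma gamma_closed simple_path_imp_path by auto
    moreover have "a \<notin> ?\<Gamma>" using a stability_region_complement by blast
    ultimately show "a \<in> inside ?\<Gamma>" using inside_Un_outside[of ?\<Gamma>] by blast
  qed
  \<comment> \<open>some point of the real interval, which is nonempty as \<open>Lambda\<close> is positive\<close>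
  have "of_real (1 - Lambda q \<alpha> / 2) \<in> stability_region \<alpha> q"
    unfolding stability_region_eq using char_fun_real_nonzero[of "1 - Lambda q \<alpha> / 2"] Lambda_pos by auto
  with sub have meet: "stability_region \<alpha> q \<inter> inside ?\<Gamma> \<noteq> {}" by blast
  have "connected (inside ?\<Gamma>)"
    using Jordan_inside_outside[OF simple_path_gamma gamma_closed] by blast
  moreover have "inside ?\<Gamma> \<subseteq> stability_region \<alpha> q \<union> ?T"
    using stability_region_complement inside_no_overlap[of ?\<Gamma>] by blast
  moreover have "stability_region \<alpha> q \<inter> ?T \<inter> inside ?\<Gamma> = {}"
    using stability_region_complement by blast
  ultimately have "?T \<inter> inside ?\<Gamma> = {}"
    using meet connectedD[OF _ open_stability_region open_image_punctured_disc] by blast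
  then show "inside ?\<Gamma> \<subseteq> stability_region \<alpha> q"
    using stability_region_complement inside_no_overlap[of ?\<Gamma>] by blast
qed

lemma frontier_stability_region: "frontier (stability_region \<alpha> q) = path_image (gamma_path \<alpha> q)"
  unfolding stability_region_eq_inside
  using Jordan_inside_outside[OF simple_path_gamma gamma_closed] by blast

text \<open>The real map embeds into the complex one with the same parameter.\<close>

lemma zero_asymp_stable_interval:
  fixes a :: real
  assumes "1 - Lambda q \<alpha> < a" "a < 1"
  shows "zero_asymp_stable \<alpha> q a"
  using char_fun_real_nonzero[OF assms] by (intro zero_asymp_stable_real unit_fps_tendsto_0)

end

theorem theorem3p1:
  fixes \<alpha> q :: real
  assumes "0 < \<alpha>" and "\<alpha> < 1" and "0 \<le> q" and "q < 1"
  shows "(\<forall>a::real. 1 - Lambda q \<alpha> < a \<and> a < 1 \<longrightarrow> zero_asymp_stable \<alpha> q a) \<and>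
    frontier (stability_region \<alpha> q) = path_image (gamma_path \<alpha> q) \<and>
    stability_region \<alpha> q \<inter> outside (path_image (gamma_path \<alpha> q)) = {} \<and>
    simple_path (gamma_path \<alpha> q) \<and>
    pathfinish (gamma_path \<alpha> q) = pathstart (gamma_path \<alpha> q) \<and>
    bounded (path_image (gamma_path \<alpha> q)) \<and>
    positively_oriented (gamma_path \<alpha> q) \<and>
    (\<forall>a::complex. a \<in> inside (path_image (gamma_path \<alpha> q)) \<longrightarrow> zero_asymp_stable \<alpha> q a)"
proof -
  interpret fractional_q \<alpha> q using assms by unfold_locales
  have "stability_region \<alpha> q \<inter> outside (path_image (gamma_path \<alpha> q)) = {}"
    unfolding stability_region_eq_inside by simp
  moreover have "bounded (path_image (gamma_path \<alpha> q))"
    by (rule bounded_simple_path_image[OF simple_path_gamma])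
  moreover have "positively_oriented (gamma_path \<alpha> q)"
    unfolding positively_oriented_def stability_region_eq_inside[symmetric]
    using winding_number_gamma by blast
  moreover have "zero_asymp_stable \<alpha> q a" if "a \<in> inside (path_image (gamma_path \<alpha> q))" for a
    using that unfolding stability_region_eq_inside[symmetric] stability_region_def by simp
  ultimately show ?thesis
    using zero_asymp_stable_interval frontier_stability_region simple_path_gamma gamma_closed by blast
qed

end
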